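(* For every $b>1$, the $b$-scaling strategy $D_b$ extended to release dates is $\frac{2b^4}{2b^2-3b+1}$-competitive for online single-machine scheduling with release dates minimizing $\sum_j w_jC_j$, compared against the optimal preemptive offline schedule. In particular, the ratio is minimized for $b=\frac{9+\sqrt{17}}{8}$, yielding a performance guarantee of $\frac{107+51\sqrt{17}}{32}\approx 9.915$.
   Context: An instance $I=(\vec p,\vec w,\vec r)$ consists of $n$ jobs with processing times $p_j>0$, weights $w_j>0$ and release dates $r_j\geq0$; jobs are unknown before their release and processing times are unknown until completion. $\mathrm{OPT}(I)$ is the optimal objective value $\sum_jw_jC_j$ of a clairvoyant offline preemptive single-machine schedule respecting release dates. Kill-and-restart model: the strategy probes released unfinished jobs one at a time; a probing of $j$ for time $\tau$ completes $j$ after $p_j$ time units if $\tau\geq p_j$, otherwise it ends after $\tau$ time units and all progress of $j$ is lost. Extended $b$-scaling strategy $D_b$: each job $j$ has a rank $q_j(\theta)$ at time $\theta$, the largest integer $q$ such that $j$ has already been probed for $w_jb^{q-1}$ before $\theta$. Whenever a probing ends (or the machine is idle and jobs are available) at time $\theta$, it selects among the released, not completed jobs the one with minimum rank, ties broken by minimum index, and probes it for $w_jb^{q_j(\theta)}$; probings are never interrupted. The rank of a job is initialized to $q_0$ at its release, and $D_b$ is the limit strategy as $q_0\to-\infty$ (so phases of infinitesimal probing occur after each release date). *)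

theory Defs
  imports "HOL-Analysis.Analysis"
begin

text \<open>The jobs of an instance are \<open>0, \<dots>, num_jobs I - 1\<close>; the values of \<open>proc\<close>, \<open>weight\<close> and
  \<open>release\<close> at other arguments are irrelevant.\<close>

record job_instance =
  num_jobs :: nat
  proc :: "nat \<Rightarrow> real"
  weight :: "nat \<Rightarrow> real"
  release :: "nat \<Rightarrow> real"

definition valid_instance :: "job_instance \<Rightarrow> bool" where
  "valid_instance I \<longleftrightarrow>
     (\<forall>j<num_jobs I. proc I j > 0 \<and> weight I j > 0 \<and> release I j \<ge> 0)"

subsection \<open>Optimal preemptive offline schedules\<close>

text \<open>A preemptive schedule tells at each time which job, if any, occupies the machine. Arbitrary
  Lebesgue-measurable allocations are admitted, not only those with finitely many preemptions.\<close>

definition processed :: "(real \<Rightarrow> nat option) \<Rightarrow> nat \<Rightarrow> real \<Rightarrow> real" where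
  "processed \<sigma> j t = measure lebesgue {s \<in> {0..t}. \<sigma> s = Some j}"

definition preemptive_schedule :: "job_instance \<Rightarrow> (real \<Rightarrow> nat option) \<Rightarrow> bool" where
  "preemptive_schedule I \<sigma> \<longleftrightarrow>
     (\<forall>t j. \<sigma> t = Some j \<longrightarrow> j < num_jobs I \<and> release I j \<le> t) \<and>
     (\<forall>j<num_jobs I. {t. \<sigma> t = Some j} \<in> sets lebesgue) \<and>
     (\<forall>j<num_jobs I. \<exists>t. processed \<sigma> j t \<ge> proc I j)"

definition preemptive_completion :: "job_instance \<Rightarrow> (real \<Rightarrow> nat option) \<Rightarrow> nat \<Rightarrow> real" where
  "preemptive_completion I \<sigma> j = Inf {t. processed \<sigma> j t \<ge> proc I j}"

definition OPT :: "job_instance \<Rightarrow> real" where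
  "OPT I = Inf {(\<Sum>j<num_jobs I. weight I j * preemptive_completion I \<sigma> j) | \<sigma>.
                  preemptive_schedule I \<sigma>}"

subsection \<open>The kill-and-restart model\<close>

text \<open>The execution is observed only at the ends of probings and of idle periods. The set
  \<open>probed\<close> contains the pairs \<open>(j, \<tau>)\<close> such that \<open>j\<close> has already been probed for time \<open>\<tau>\<close>, and
  \<open>completed s j\<close> is the completion time of \<open>j\<close> once \<open>j\<close> is completed.\<close>

record exec_state =
  clock :: real
  probed :: "(nat \<times> real) set"
  completed :: "nat \<Rightarrow> real option"

definition init_state :: exec_state where
  "init_state = \<lparr>clock = 0, probed = {}, completed = (\<lambda>_. None)\<rparr>"

definition available :: "job_instance \<Rightarrow> exec_state \<Rightarrow> nat set" where
  "available I s = {j. j < num_jobs I \<and> release I j \<le> clock s \<and> completed s j = None}"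

definition probe :: "job_instance \<Rightarrow> nat \<Rightarrow> real \<Rightarrow> exec_state \<Rightarrow> exec_state" where
  "probe I j \<tau> s =
     (if proc I j \<le> \<tau>
      then \<lparr>clock = clock s + proc I j,
            probed = insert (j, \<tau>) (probed s),
            completed = (completed s)(j \<mapsto> clock s + proc I j)\<rparr>
      else \<lparr>clock = clock s + \<tau>,
            probed = insert (j, \<tau>) (probed s),
            completed = completed s\<rparr>)"

definition idle_until_release :: "job_instance \<Rightarrow> exec_state \<Rightarrow> exec_state" where
  "idle_until_release I s =
     s\<lparr>clock := Min (release I ` {j. j < num_jobs I \<and> completed s j = None})\<rparr>"

subsection \<open>The extended scaling strategy\<close>

text \<open>In the following, \<open>q0\<close> is the rank that every job has at its release.\<close>

definition rank :: "real \<Rightarrow> int \<Rightarrow> job_instance \<Rightarrow> exec_state \<Rightarrow> nat \<Rightarrow> int" where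
  "rank b q0 I s j =
     Max (insert q0 {q. (j, weight I j * b powi (q - 1)) \<in> probed s})"

definition next_job :: "real \<Rightarrow> int \<Rightarrow> job_instance \<Rightarrow> exec_state \<Rightarrow> nat" where
  "next_job b q0 I s =
     (LEAST j. j \<in> available I s \<and>
               (\<forall>i\<in>available I s. rank b q0 I s j \<le> rank b q0 I s i))"

definition scaling_step :: "real \<Rightarrow> int \<Rightarrow> job_instance \<Rightarrow> exec_state \<Rightarrow> exec_state" where
  "scaling_step b q0 I s =
     (if available I s \<noteq> {}
      then let j = next_job b q0 I s
           in probe I j (weight I j * b powi rank b q0 I s j) s
      else if \<exists>j<num_jobs I. completed s j = None
      then idle_until_release I s
      else s)"

definition truncated_completion :: "real \<Rightarrow> int \<Rightarrow> job_instance \<Rightarrow> nat \<Rightarrow> real" where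
  "truncated_completion b q0 I j =
     (THE t. \<exists>m. completed ((scaling_step b q0 I ^^ m) init_state) j = Some t)"

text \<open>The limit strategy \<open>D\<^sub>b\<close> is given by its completion times, the limits of the completion
  times for initial rank \<open>q0\<close> as \<open>q0\<close> tends to \<open>-\<infinity>\<close>. These limits exist: for all sufficiently small
  \<open>q0\<close>, the completion time of a job is of the form \<open>\<alpha> + \<gamma> * b powi q0\<close>. If, in the limit, a
  probing ends exactly at a release date \<open>r\<close>, then for each \<open>q0\<close> it may end slightly before \<open>r\<close>, in
  which case the job released at \<open>r\<close> waits for the probing that follows.\<close>

definition scaling_completion :: "real \<Rightarrow> job_instance \<Rightarrow> nat \<Rightarrow> real" where
  "scaling_completion b I j = Lim at_bot (\<lambda>q0. truncated_completion b q0 I j)"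

definition scaling_cost :: "real \<Rightarrow> job_instance \<Rightarrow> real" where
  "scaling_cost b I = (\<Sum>j<num_jobs I. weight I j * scaling_completion b I j)"

definition competitive :: "(job_instance \<Rightarrow> real) \<Rightarrow> real \<Rightarrow> bool" where
  "competitive cost c \<longleftrightarrow> (\<forall>I. valid_instance I \<longrightarrow> cost I \<le> c * OPT I)"

definition scaling_ratio :: "real \<Rightarrow> real" where
  "scaling_ratio b = 2 * b ^ 4 / (2 * b\<^sup>2 - 3 * b + 1)"

end

theory Submission
  imports Defs
begin

text \<open>Fix an initial rank. A job released during a probing waits for its end; since the probed job has
  already received all shorter probings, this multiplies the effective release date by at most \<open>b\<close>,
  up to a vanishing term. Relative to the effective release dates, the strategy serves the jobs by
  increasing level, the total time \<open>w b\<^sup>q\<^sup>+\<^sup>1 / (b - 1)\<close> granted to a job with weight \<open>w\<close> up to rank \<open>q\<close>.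
  So a job that completes at rank \<open>q\<close> completes by the end of its block at level \<open>q\<close>, a maximal period
  without probings of rank above \<open>q\<close>. Summation by parts over the levels compares the weighted block
  ends with the lower bounds that single-machine capacity imposes, for each level \<open>q\<close> separately, on the
  jobs of final rank at most \<open>q\<close> in an arbitrary preemptive schedule; this costs a factor of 2.
  Processing times and release dates are inflated by at most the factor \<open>b\<^sup>2 / (b - 1)\<close>. The resulting
  bound \<open>2 b\<^sup>2 / (b - 1)\<close> is at most the claimed ratio because \<open>2 b - 1 \<le> b\<^sup>2\<close>.

  The limits that define the strategy exist because for small initial ranks the execution passes through
  states whose clocks and completion times are affine in \<open>b powi q0\<close>. Infinitesimal phases, whose
  number of probings depends on \<open>q0\<close>, are bridged as a whole.\<close>

section \<open>Lower bounds on preemptive completion times\<close>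

lemma processed_mono:
  assumes "{t. \<sigma> t = Some j} \<in> sets lebesgue" "s \<le> t"
  shows "processed \<sigma> j s \<le> processed \<sigma> j t"
proof -
  have eq: "{x \<in> {0..t}. \<sigma> x = Some j} = {0..t} \<inter> {x. \<sigma> x = Some j}" for t
    by auto
  have meas: "{0..t} \<inter> {x. \<sigma> x = Some j} \<in> lmeasurable" for t
    using assms(1) by (intro fmeasurable_Int_fmeasurable) auto
  show ?thesis
    unfolding processed_def eq
    using assms(2) meas by (intro measure_mono_fmeasurable) (auto simp: fmeasurableD)
qed

text \<open>Strictly after the infimum some \<open>s < t\<close> lies in the defining set, and
  monotonicity carries the bound to \<open>t\<close>. Working with such \<open>t\<close> sidesteps
  the question whether the infimum is attained.\<close>

lemma processed_after_completion:
  assumes \<sigma>: "preemptive_schedule I \<sigma>"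
    and j: "j < num_jobs I" and t: "preemptive_completion I \<sigma> j < t"
  shows "proc I j \<le> processed \<sigma> j t"
proof -
  obtain s where "proc I j \<le> processed \<sigma> j s" "s < t"
    using cInf_lessD[of "{t. proc I j \<le> processed \<sigma> j t}" t] \<sigma> j t
    by (auto simp: preemptive_completion_def preemptive_schedule_def)
  then show ?thesis
    using processed_mono[of \<sigma> j s t] \<sigma> j by (auto simp: preemptive_schedule_def)
qed

text \<open>The machine serves one job at a time, so the time sets of different jobs are disjoint;
  those of the jobs in \<open>B\<close> lie in \<open>{x..t}\<close> because none of these jobs is
  released before \<open>x\<close>.\<close>

lemma sum_processed_le:
  assumes \<sigma>: "preemptive_schedule I \<sigma>" and B: "B \<subseteq> {..<num_jobs I}"
    and x: "0 \<le> x" "x \<le> t" "\<And>k. k \<in> B \<Longrightarrow> x \<le> release I k"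
  shows "(\<Sum>k\<in>B. processed \<sigma> k t) \<le> t - x"
proof -
  define X where "X k = {x..t} \<inter> {s. \<sigma> s = Some k}" for k
  have X: "{s \<in> {0..t}. \<sigma> s = Some k} = X k" if "k \<in> B" for k
    using \<sigma> x that unfolding preemptive_schedule_def X_def by force
  have meas: "X k \<in> lmeasurable" if "k \<in> B" for k
    unfolding X_def using \<sigma> B that
    by (intro fmeasurable_Int_fmeasurable) (auto simp: preemptive_schedule_def)
  have fin: "finite B"
    using B finite_subset by blast
  have "(\<Sum>k\<in>B. processed \<sigma> k t) = (\<Sum>k\<in>B. measure lebesgue (X k))"
    using X by (intro sum.cong) (simp_all only: processed_def)
  also have "\<dots> = measure lebesgue (\<Union>k\<in>B. X k)"
    using fin meas by (intro measure_UNION'[symmetric]) (auto simp: pairwise_def disjnt_def X_def)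
  also have "\<dots> \<le> measure lebesgue {x..t}"
  proof (rule measure_mono_fmeasurable)
    show "(\<Union>k\<in>B. X k) \<in> sets lebesgue"
      using fin meas by (intro sets.finite_UN fmeasurableD) auto
  qed (auto simp: X_def)
  also have "\<dots> = t - x"
    using x by simp
  finally show ?thesis .
qed

lemma completion_ge_start:
  assumes I: "valid_instance I" and \<sigma>: "preemptive_schedule I \<sigma>"
    and j: "j < num_jobs I" and x: "0 \<le> x" "x \<le> release I j"
  shows "x \<le> preemptive_completion I \<sigma> j"
proof (rule ccontr)
  assume "\<not> ?thesis"
  then obtain t where t: "preemptive_completion I \<sigma> j < t" "t < x"
    using dense[of "preemptive_completion I \<sigma> j" x] by auto
  have "{s \<in> {0..t}. \<sigma> s = Some j} = {}"
    using \<sigma> t x by (force simp: preemptive_schedule_def)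
  then have "processed \<sigma> j t = 0"
    by (simp only: processed_def measure_empty)
  then show False
    using processed_after_completion[OF \<sigma> j t(1)] I j by (auto simp: valid_instance_def)
qed

text \<open>Right after the completion of \<open>j\<close>, every job of \<open>B\<close> completed
  no later is fully processed, and all this work was done after \<open>x\<close>. Letting
  \<open>t\<close> decrease to the completion time gives the bound.\<close>

lemma completion_ge:
  assumes I: "valid_instance I" and \<sigma>: "preemptive_schedule I \<sigma>"
    and B: "B \<subseteq> {..<num_jobs I}" and x: "0 \<le> x" "\<And>k. k \<in> B \<Longrightarrow> x \<le> release I k"
    and j: "j \<in> B"
  shows "x + (\<Sum>k | k \<in> B \<and> preemptive_completion I \<sigma> k \<le> preemptive_completion I \<sigma> j. proc I k)
         \<le> preemptive_completion I \<sigma> j"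
    (is "x + (\<Sum>k\<in>?B. _) \<le> ?C j")
proof (rule dense_ge)
  fix t assume t: "?C j < t"
  have "x \<le> t"
    using completion_ge_start[OF I \<sigma>, of j x] B x j t by auto
  have "(\<Sum>k\<in>?B. proc I k) \<le> (\<Sum>k\<in>?B. processed \<sigma> k t)"
    using t B by (intro sum_mono processed_after_completion[OF \<sigma>]) auto
  also have "\<dots> \<le> t - x"
    using B x \<open>x \<le> t\<close> by (intro sum_processed_le[OF \<sigma>]) auto
  finally show "x + (\<Sum>k\<in>?B. proc I k) \<le> t"
    by simp
qed

text \<open>For each pair of jobs, at least one of the two orders agrees with \<open>C\<close>.\<close>

lemma sum_square_le_ordered:
  fixes P C :: "nat \<Rightarrow> real"
  assumes "finite B" "\<And>k. k \<in> B \<Longrightarrow> 0 \<le> P k"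
  shows "(\<Sum>j\<in>B. P j)\<^sup>2 \<le> 2 * (\<Sum>j\<in>B. P j * (\<Sum>k | k \<in> B \<and> C k \<le> C j. P k))"
proof -
  define f where "f j k = (if C k \<le> C j then P j * P k else 0)" for j k
  have eq: "(\<Sum>j\<in>B. P j * (\<Sum>k | k \<in> B \<and> C k \<le> C j. P k)) = (\<Sum>j\<in>B. \<Sum>k\<in>B. f j k)"
    using assms(1)
    by (intro sum.cong refl) (auto simp: f_def sum_distrib_left sum.inter_filter intro!: sum.cong)
  have "(\<Sum>j\<in>B. P j)\<^sup>2 = (\<Sum>j\<in>B. \<Sum>k\<in>B. P j * P k)"
    by (simp add: power2_eq_square sum_product)
  also have "\<dots> \<le> (\<Sum>j\<in>B. \<Sum>k\<in>B. f j k + f k j)"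
    using assms(2) by (intro sum_mono) (auto simp: f_def)
  also have "\<dots> = (\<Sum>j\<in>B. \<Sum>k\<in>B. f j k) + (\<Sum>j\<in>B. \<Sum>k\<in>B. f k j)"
    by (simp add: sum.distrib)
  also have "(\<Sum>j\<in>B. \<Sum>k\<in>B. f k j) = (\<Sum>j\<in>B. \<Sum>k\<in>B. f j k)"
    by (rule sum.swap)
  finally show ?thesis
    by (simp add: eq)
qed

text \<open>The weights in this sum are the sizes themselves, so the order of the completions
  matters only by a factor 2 (\<open>sum_square_le_ordered\<close>). In the application
  \<open>s\<close> is the start of a block, \<open>d\<close> the error caused by the initial rank,
  and \<open>c\<close> bounds the inflation of sizes and of release dates at once.\<close>

lemma block_lower_bound:
  fixes P :: "nat \<Rightarrow> real"
  assumes I: "valid_instance I" and \<sigma>: "preemptive_schedule I \<sigma>" and B: "B \<subseteq> {..<num_jobs I}"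
    and b: "1 \<le> b" "b \<le> c" and d: "0 \<le> d" and s: "0 \<le> s"
    and rel: "\<And>k. k \<in> B \<Longrightarrow> s \<le> b * release I k + d"
    and P: "\<And>k. k \<in> B \<Longrightarrow> 0 \<le> P k" "\<And>k. k \<in> B \<Longrightarrow> P k \<le> c * proc I k"
  shows "(\<Sum>j\<in>B. P j * (s + (\<Sum>k\<in>B. P k))) \<le> 2 * c * (\<Sum>j\<in>B. P j * (preemptive_completion I \<sigma> j + d))"
proof -
  let ?C = "preemptive_completion I \<sigma>"
  let ?F = "\<lambda>j. \<Sum>k | k \<in> B \<and> ?C k \<le> ?C j. P k"
  \<comment> \<open>The bound \<open>rel\<close> solved for the release date, truncated at 0 since
    \<open>completion_ge\<close> asks for a nonnegative start.\<close>
  define x where "x = max 0 ((s - d) / b)"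
  have fin: "finite B"
    using B finite_subset by blast
  have key: "s + ?F j \<le> c * (?C j + d)" if j: "j \<in> B" for j
  proof -
    have "x \<le> release I k" if "k \<in> B" for k
      using rel[OF that] I B that b by (auto simp: x_def valid_instance_def field_simps)
    then have "x + (\<Sum>k | k \<in> B \<and> ?C k \<le> ?C j. proc I k) \<le> ?C j"
      using j by (intro completion_ge[OF I \<sigma> B]) (auto simp: x_def)
    then have "c * x + c * (\<Sum>k | k \<in> B \<and> ?C k \<le> ?C j. proc I k) \<le> c * ?C j"
      using b mult_left_mono[of _ "?C j" c] by (simp add: distrib_left[symmetric])
    moreover have "?F j \<le> c * (\<Sum>k | k \<in> B \<and> ?C k \<le> ?C j. proc I k)"
      unfolding sum_distrib_left using P by (intro sum_mono) auto
    moreover have "s - d \<le> c * x"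
    proof (cases "s \<le> d")
      case True
      then show ?thesis
        using b by (simp add: x_def) (smt (verit) mult_nonneg_nonneg)
    next
      case False
      then have "s - d \<le> c * ((s - d) / b)"
        using b mult_right_mono[of b c "s - d"] by (simp add: field_simps)
      also have "\<dots> \<le> c * x"
        using b by (intro mult_left_mono) (auto simp: x_def)
      finally show ?thesis .
    qed
    moreover have "d \<le> c * d"
      using b d by (simp add: mult_le_cancel_right1)
    ultimately show ?thesis
      by (simp add: distrib_left)
  qed
  have "(\<Sum>j\<in>B. P j * (s + (\<Sum>k\<in>B. P k))) = s * (\<Sum>j\<in>B. P j) + (\<Sum>j\<in>B. P j)\<^sup>2"
    by (simp add: distrib_left sum.distrib sum_distrib_left sum_distrib_right power2_eq_square mult.commute)
  also have "\<dots> \<le> 2 * (s * (\<Sum>j\<in>B. P j)) + 2 * (\<Sum>j\<in>B. P j * ?F j)"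
    using sum_square_le_ordered[OF fin P(1), where C = ?C] s P(1)
    by (intro add_mono) (auto intro!: mult_nonneg_nonneg sum_nonneg)
  also have "\<dots> = 2 * (\<Sum>j\<in>B. P j * (s + ?F j))"
    by (simp add: distrib_left sum.distrib sum_distrib_left mult.commute)
  also have "\<dots> \<le> 2 * (\<Sum>j\<in>B. P j * (c * (?C j + d)))"
    using key P(1) by (intro mult_left_mono sum_mono) auto
  also have "\<dots> = 2 * c * (\<Sum>j\<in>B. P j * (?C j + d))"
    by (simp add: sum_distrib_left mult_ac)
  finally show ?thesis .
qed

section \<open>Single steps of the scaling strategy\<close>

locale scaling_setting =
  fixes b :: real and I :: job_instance
  assumes b_gt_1: "b > 1" and valid: "valid_instance I"
begin

abbreviation "n \<equiv> num_jobs I"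
abbreviation "p \<equiv> proc I"
abbreviation "w \<equiv> weight I"
abbreviation "r \<equiv> release I"
abbreviation "rk q0 s \<equiv> Defs.rank b q0 I s"

lemma proc_pos: "j < n \<Longrightarrow> 0 < p j"
  and weight_pos: "j < n \<Longrightarrow> 0 < w j"
  and release_nonneg: "j < n \<Longrightarrow> 0 \<le> r j"
  using valid by (auto simp: valid_instance_def)

lemma b_pos: "0 < b" and b_nonzero: "b \<noteq> 0"
  using b_gt_1 by auto

lemma powi_pos: "0 < b powi q"
  using b_pos by simp

lemma powi_le_iff: "b powi q \<le> b powi q' \<longleftrightarrow> q \<le> q'"
  by (metis b_gt_1 power_int_strict_increasing power_int_increasing less_le_not_le linorder_not_le
      order_less_imp_le)

lemma powi_eq_iff: "b powi q = b powi q' \<longleftrightarrow> q = q'"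
  by (metis order_antisym order_refl powi_le_iff)

lemma powi_Suc: "b powi (q + 1) = b * b powi q"
  using b_nonzero by (simp add: power_int_add)

text \<open>The rank of the successful probing: the least one whose probing time covers the
  processing time.\<close>

definition final_rank :: "nat \<Rightarrow> int" where
  "final_rank j = \<lceil>log b (p j / w j)\<rceil>"

lemma final_rank_le_iff:
  assumes "j < n"
  shows "final_rank j \<le> q \<longleftrightarrow> p j \<le> w j * b powi q"
proof -
  have "final_rank j \<le> q \<longleftrightarrow> log b (p j / w j) \<le> of_int q"
    by (simp add: final_rank_def ceiling_le_iff)
  also have "\<dots> \<longleftrightarrow> p j / w j \<le> b powr of_int q"
    using b_gt_1 proc_pos[OF assms] weight_pos[OF assms] by (subst log_le_iff) auto
  also have "\<dots> \<longleftrightarrow> p j \<le> w j * b powi q"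
    using weight_pos[OF assms] b_pos by (simp add: powr_real_of_int' field_simps)
  finally show ?thesis .
qed

lemma proc_gt: "j < n \<Longrightarrow> w j * b powi (final_rank j - 1) < p j"
  using final_rank_le_iff[of j "final_rank j - 1"] by auto

text \<open>A state records probing times, not ranks. Since \<open>w j * b powi (q - 1)\<close>
  determines \<open>q\<close>, finitely many probings give finitely many ranks, so that the
  \<open>Max\<close> in \<open>rank\<close> is meaningful.\<close>

lemma finite_probed_ranks:
  assumes "finite (probed s)" "j < n"
  shows "finite {q. (j, w j * b powi (q - 1)) \<in> probed s}"
proof (rule finite_imageD)
  show "finite ((\<lambda>q. (j, w j * b powi (q - 1))) ` {q. (j, w j * b powi (q - 1)) \<in> probed s})"
    by (rule finite_subset[OF _ assms(1)]) auto
  show "inj_on (\<lambda>q. (j, w j * b powi (q - 1))) {q. (j, w j * b powi (q - 1)) \<in> probed s}"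
    using weight_pos[OF assms(2)] powi_eq_iff by (auto intro!: inj_onI)
qed

lemma rank_probe:
  assumes "finite (probed s)" "j < n" "k < n"
  shows "rk q0 (probe I j (w j * b powi rk q0 s j) s) k
         = (if k = j then rk q0 s j + 1 else rk q0 s k)"
proof -
  let ?s' = "probe I j (w j * b powi rk q0 s j) s"
  have probed: "probed ?s' = insert (j, w j * b powi rk q0 s j) (probed s)"
    by (simp add: probe_def)
  show ?thesis
  proof (cases "k = j")
    case True
    let ?X = "{q. (j, w j * b powi (q - 1)) \<in> probed s}"
    have "w j * b powi (q - 1) = w j * b powi rk q0 s j \<longleftrightarrow> q = rk q0 s j + 1" for q
      using weight_pos[OF assms(2)] powi_eq_iff[of "q - 1" "rk q0 s j"] by auto
    then have "{q. (j, w j * b powi (q - 1)) \<in> probed ?s'} = insert (rk q0 s j + 1) ?X"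
      by (auto simp: probed)
    then have "rk q0 ?s' j = Max (insert (rk q0 s j + 1) (insert q0 ?X))"
      by (simp add: Defs.rank_def insert_commute)
    also have "\<dots> = max (rk q0 s j + 1) (rk q0 s j)"
      using finite_probed_ranks[OF assms(1,2)] by (subst Max_insert) (auto simp: Defs.rank_def)
    finally show ?thesis
      using True by simp
  next
    case False
    then have "{q. (k, w k * b powi (q - 1)) \<in> probed ?s'} = {q. (k, w k * b powi (q - 1)) \<in> probed s}"
      by (auto simp: probed)
    with False show ?thesis
      by (simp add: Defs.rank_def[of b q0 I _ k])
  qed
qed

lemma finite_available: "finite (available I s)"
  by (simp add: available_def)

lemma next_job:
  assumes "available I s \<noteq> {}"
  shows "next_job b q0 I s \<in> available I s"
    and "i \<in> available I s \<Longrightarrow> rk q0 s (next_job b q0 I s) \<le> rk q0 s i"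
proof -
  let ?P = "\<lambda>j. j \<in> available I s \<and> (\<forall>i\<in>available I s. rk q0 s j \<le> rk q0 s i)"
  have "\<exists>j. ?P j"
    using ex_min_if_finite[of "rk q0 s ` available I s"] assms finite_available
    by (auto simp: not_less)
  then have "?P (next_job b q0 I s)"
    unfolding next_job_def by (rule LeastI_ex)
  then show "next_job b q0 I s \<in> available I s"
    and "i \<in> available I s \<Longrightarrow> rk q0 s (next_job b q0 I s) \<le> rk q0 s i"
    by auto
qed

text \<open>Links completion to the rank: the probing at the final rank succeeds and raises the rank
  beyond it. Ranks alone then decide which jobs are still open.\<close>

definition consistent :: "int \<Rightarrow> exec_state \<Rightarrow> bool" where
  "consistent q0 s \<longleftrightarrow> finite (probed s) \<and>
     (\<forall>j<n. completed s j = None \<longleftrightarrow> rk q0 s j \<le> final_rank j)"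

lemma step_probe:
  assumes s: "consistent q0 s" and av: "available I s \<noteq> {}"
  defines "j \<equiv> next_job b q0 I s" and "s' \<equiv> scaling_step b q0 I s"
  shows "clock s' = clock s + min (p j) (w j * b powi rk q0 s j)"
    and "\<And>k. k < n \<Longrightarrow> rk q0 s' k = (if k = j then rk q0 s j + 1 else rk q0 s k)"
    and "completed s' = (if final_rank j \<le> rk q0 s j
           then (completed s)(j \<mapsto> clock s') else completed s)"
    and "consistent q0 s'"
proof -
  have s'_eq: "s' = probe I j (w j * b powi rk q0 s j) s"
    using av by (simp add: s'_def j_def scaling_step_def Let_def)
  have j: "j \<in> available I s"
    using next_job(1)[OF av] by (simp add: j_def)
  then have jn: "j < n" and "completed s j = None"
    by (auto simp: available_def)
  then have le: "rk q0 s j \<le> final_rank j"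
    using s by (auto simp: consistent_def)
  have fin: "finite (probed s)"
    using s by (simp add: consistent_def)
  show "clock s' = clock s + min (p j) (w j * b powi rk q0 s j)"
    by (auto simp: s'_eq probe_def min_def)
  show rk': "\<And>k. k < n \<Longrightarrow> rk q0 s' k = (if k = j then rk q0 s j + 1 else rk q0 s k)"
    unfolding s'_eq using rank_probe[OF fin jn] by simp
  show co: "completed s' = (if final_rank j \<le> rk q0 s j
           then (completed s)(j \<mapsto> clock s') else completed s)"
    by (auto simp: s'_eq probe_def final_rank_le_iff[OF jn])
  have "finite (probed s')"
    using fin by (simp add: s'_eq probe_def)
  then show "consistent q0 s'"
    using s le by (auto simp: consistent_def rk' co)
qed

lemma step_idle:
  fixes q0 :: int
  assumes "available I s = {}" "j < n" "completed s j = None"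
  defines "s' \<equiv> scaling_step b q0 I s"
  shows "clock s' = Min (r ` {j. j < n \<and> completed s j = None})"
    and "rk q0 s' = rk q0 s" and "completed s' = completed s" and "probed s' = probed s"
  using assms by (auto simp: scaling_step_def idle_until_release_def Defs.rank_def fun_eq_iff)

lemma step_done:
  assumes "\<And>j. j < n \<Longrightarrow> completed s j \<noteq> None"
  shows "scaling_step b q0 I s = s"
  using assms by (force simp: scaling_step_def available_def)

lemma step_consistent:
  assumes "consistent q0 s"
  shows "consistent q0 (scaling_step b q0 I s)"
proof (cases "available I s = {}")
  case True
  show ?thesis
  proof (cases "\<exists>j<n. completed s j = None")
    case True
    then show ?thesis
      using step_idle[OF \<open>available I s = {}\<close>] assms unfolding consistent_def by metis
  next
    case False
    then show ?thesis
      using step_done assms by metis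
  qed
qed (use assms step_probe(4) in blast)

lemma idle_clock_ge:
  assumes "available I s = {}" "j < n" "completed s j = None"
  shows "clock s < clock (scaling_step b q0 I s)" "clock (scaling_step b q0 I s) \<le> r j"
proof -
  let ?X = "r ` {j. j < n \<and> completed s j = None}"
  have "?X \<noteq> {}" "finite ?X"
    using assms by auto
  moreover have "clock s < x" if "x \<in> ?X" for x
    using assms(1) that by (force simp: available_def)
  ultimately show "clock s < clock (scaling_step b q0 I s)" "clock (scaling_step b q0 I s) \<le> r j"
    using assms(2,3) by (auto simp: step_idle(1)[OF assms])
qed

lemma step_clock_mono:
  assumes "consistent q0 s"
  shows "clock s \<le> clock (scaling_step b q0 I s)"
proof (cases "available I s = {}")
  case True
  show ?thesis
  proof (cases "\<exists>j<n. completed s j = None")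
    case True
    then show ?thesis
      using idle_clock_ge(1)[OF \<open>available I s = {}\<close>] by (meson less_imp_le)
  next
    case False
    then have "scaling_step b q0 I s = s"
      using step_done by metis
    then show ?thesis by simp
  qed
next
  case False
  then have "next_job b q0 I s < n"
    using next_job(1) by (auto simp: available_def)
  then show ?thesis
    using step_probe(1)[OF assms False] proc_pos weight_pos powi_pos
    by (simp add: less_imp_le)
qed

end

section \<open>Blocks of an execution\<close>

text \<open>Termination is a hypothesis here; for all small \<open>q0\<close> it is supplied by
  \<open>scaling_completion_limit\<close>. The bound on \<open>q0\<close> makes the initial state
  consistent.\<close>

locale scaling_run = scaling_setting +
  fixes q0 :: int
  assumes q0_le: "\<And>j. j < n \<Longrightarrow> q0 \<le> final_rank j"
    and completes: "\<And>j. j < n \<Longrightarrow> \<exists>m. completed ((scaling_step b q0 I ^^ m) init_state) j \<noteq> None"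
begin

section \<open>The sequence of observed states\<close>

definition "S m = (scaling_step b q0 I ^^ m) init_state"

abbreviation "T m \<equiv> clock (S m)"
abbreviation "R m \<equiv> rk q0 (S m)"

lemma S_0: "S 0 = init_state" and S_Suc: "S (Suc m) = scaling_step b q0 I (S m)"
  by (simp_all add: S_def)

lemma R_0: "R 0 k = q0"
  by (simp add: S_0 init_state_def Defs.rank_def)

lemma consistent_S: "consistent q0 (S m)"
proof (induction m)
  case 0
  then show ?case
    using q0_le R_0 by (auto simp: consistent_def S_0 init_state_def)
qed (simp add: S_Suc step_consistent)

lemma T_mono: "i \<le> m \<Longrightarrow> T i \<le> T m"
  by (induction rule: dec_induct) (use S_Suc step_clock_mono[OF consistent_S] in \<open>auto intro: order_trans\<close>)

lemma T_nonneg: "0 \<le> T m"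
  using T_mono[of 0 m] by (simp add: S_0 init_state_def)

lemma completed_iff: "k < n \<Longrightarrow> completed (S m) k = None \<longleftrightarrow> R m k \<le> final_rank k"
  using consistent_S by (simp add: consistent_def)

lemma R_Suc:
  assumes "k < n"
  shows "R (Suc m) k = (if available I (S m) \<noteq> {} \<and> k = next_job b q0 I (S m) then R m k + 1 else R m k)"
proof (cases "available I (S m) = {}")
  case True
  show ?thesis
  proof (cases "\<exists>j<n. completed (S m) j = None")
    case True
    then show ?thesis
      using \<open>available I (S m) = {}\<close> step_idle(2) by (metis S_Suc)
  next
    case False
    then show ?thesis
      using \<open>available I (S m) = {}\<close> step_done by (metis S_Suc)
  qed
next
  case False
  then show ?thesis
    using step_probe(2)[OF consistent_S] assms by (auto simp: S_Suc)
qed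

lemma R_mono: "i \<le> m \<Longrightarrow> k < n \<Longrightarrow> R i k \<le> R m k"
  by (induction rule: dec_induct) (auto simp: R_Suc)

lemma R_Suc_unavailable: "k < n \<Longrightarrow> k \<notin> available I (S m) \<Longrightarrow> R (Suc m) k = R m k"
  using R_Suc[of k m] next_job(1)[of "S m" q0] by auto

lemma R_le: "k < n \<Longrightarrow> R m k \<le> final_rank k + 1"
proof (induction m)
  case 0
  then show ?case using q0_le[of k] by (simp add: R_0)
next
  case (Suc m)
  show ?case
  proof (cases "k \<in> available I (S m)")
    case True
    then show ?thesis
      using Suc completed_iff[of k m] R_Suc[of k m] by (auto simp: available_def)
  qed (use Suc R_Suc_unavailable in auto)
qed

lemma completed_Suc:
  "completed (S (Suc m)) k = Some t \<Longrightarrow> completed (S m) k = None \<Longrightarrow> k < n \<Longrightarrow>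
    k \<in> available I (S m) \<and> T (Suc m) = t"
  using completed_iff[of k m] completed_iff[of k "Suc m"] R_Suc_unavailable[of k m]
    step_probe(3)[OF consistent_S[of m]]
  by (cases "available I (S m) = {}") (auto simp: S_Suc split: if_splits)

lemma completed_Suc_Some:
  assumes "completed (S m) k = Some t"
  shows "completed (S (Suc m)) k = Some t"
proof (cases "available I (S m) = {}")
  case True
  show ?thesis
  proof (cases "\<exists>j<n. completed (S m) j = None")
    case True
    then show ?thesis
      using \<open>available I (S m) = {}\<close> step_idle(3) assms by (metis S_Suc)
  next
    case False
    then show ?thesis
      using \<open>available I (S m) = {}\<close> step_done assms by (metis S_Suc)
  qed
next
  case False
  moreover have "k \<notin> available I (S m)"
    using assms by (simp add: available_def)
  ultimately show ?thesis
    using step_probe(3)[OF consistent_S[of m]] next_job(1)[of "S m"] assms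
    by (auto simp: S_Suc)
qed

lemma completed_mono: "i \<le> m \<Longrightarrow> completed (S i) k = Some t \<Longrightarrow> completed (S m) k = Some t"
  by (induction m rule: dec_induct) (auto intro: completed_Suc_Some)

lemma completed_unique: "completed (S i) k = Some t \<Longrightarrow> completed (S m) k = Some t' \<Longrightarrow> t = t'"
  using completed_mono[of i "max i m" k t] completed_mono[of m "max i m" k t'] by simp

lemma first_completed:
  assumes "k < n"
  obtains m where "completed (S (Suc m)) k = Some (T (Suc m))" "k \<in> available I (S m)"
    "\<And>i. i \<le> m \<Longrightarrow> completed (S i) k = None"
proof -
  define M where "M = (LEAST m. completed (S m) k \<noteq> None)"
  have M: "completed (S M) k \<noteq> None"
    unfolding M_def by (rule LeastI_ex) (use completes[OF assms] in \<open>simp add: S_def\<close>)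
  have before: "completed (S i) k = None" if "i < M" for i
    using that not_less_Least unfolding M_def by blast
  have "M \<noteq> 0"
    using M S_0 by (cases "M = 0") (auto simp: init_state_def)
  then obtain m where m: "M = Suc m"
    using not0_implies_Suc by blast
  obtain t where t: "completed (S (Suc m)) k = Some t"
    using M m by auto
  have None: "completed (S i) k = None" if "i \<le> m" for i
    using before m that by simp
  show thesis
    using completed_Suc[OF t None[OF order_refl] assms] t None by (intro that) auto
qed

text \<open>\<open>T (arrival k)\<close> is the effective release date of \<open>k\<close>: the
  first observed time at which the strategy can react to the release.\<close>

definition arrival :: "nat \<Rightarrow> nat" where
  "arrival k = (LEAST m. r k \<le> T m)"

lemma arrival_le_iff:
  assumes "k < n"
  shows "arrival k \<le> i \<longleftrightarrow> r k \<le> T i"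
proof -
  obtain m where "r k \<le> T m"
    using first_completed[OF assms] by (auto simp: available_def)
  then have "r k \<le> T (arrival k)"
    unfolding arrival_def by (rule LeastI)
  then show ?thesis
    using T_mono[of "arrival k" i] Least_le[of "\<lambda>m. r k \<le> T m" i] by (auto simp: arrival_def)
qed

lemma R_before_arrival: "k < n \<Longrightarrow> i \<le> arrival k \<Longrightarrow> R i k = q0"
proof (induction i)
  case (Suc i)
  then have "k \<notin> available I (S i)"
    using arrival_le_iff[of k i] by (auto simp: available_def)
  then show ?case
    using Suc R_Suc_unavailable by auto
qed (simp add: R_0)

text \<open>The state with index \<open>i\<close> is a break at level \<open>q\<close> if it is initial, or is preceded by idling or by
  a probing of rank above \<open>q\<close>. The breaks partition the jobs, according to their arrivals, into the
  blocks of level \<open>q\<close>, and the blocks of level \<open>q + 1\<close> are unions of those of level \<open>q\<close>.\<close>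

definition level_break :: "int \<Rightarrow> nat \<Rightarrow> bool" where
  "level_break q i \<longleftrightarrow> i = 0 \<or> (\<forall>k\<in>available I (S (i - 1)). q < R (i - 1) k)"

text \<open>The geometric series of \<open>b powi i\<close> over all \<open>i \<le> q\<close>: the
  probing time per unit of weight up to rank \<open>q\<close>, counted from rank minus
  infinity.\<close>

definition u :: "int \<Rightarrow> real" where
  "u q = b powi (q + 1) / (b - 1)"

text \<open>What \<open>k\<close> can cost at level \<open>q\<close>: no probing follows the one at
  the final rank, and that one is charged at full length.\<close>

definition work :: "int \<Rightarrow> nat \<Rightarrow> real" where
  "work q k = w k * u (min q (final_rank k))"

lemma u_le_iff: "u q \<le> u q' \<longleftrightarrow> q \<le> q'"
  using b_gt_1 powi_le_iff[of "q + 1" "q' + 1"] by (simp add: u_def divide_le_cancel)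

lemma u_pos: "0 < u q"
  using b_gt_1 powi_pos by (simp add: u_def)

lemma u_diff: "u (q + 1) - u q = b powi (q + 1)"
proof -
  have "u (q + 1) - u q = (b - 1) * b powi (q + 1) / (b - 1)"
    using powi_Suc[of "q + 1"] by (simp add: u_def diff_divide_distrib left_diff_distrib)
  then show ?thesis
    using b_gt_1 by simp
qed

lemma work_nonneg: "k < n \<Longrightarrow> 0 \<le> work q k"
  using u_pos weight_pos by (simp add: work_def less_imp_le)

text \<open>Up to an additive constant, \<open>w k * u (min q (R i k - 1))\<close> bounds the time that has been spent
  on probings of \<open>k\<close> with rank at most \<open>q\<close>.\<close>

lemma clock_step_bound:
  assumes "\<not> level_break q (Suc i)"
  shows "T (Suc i) - T i \<le> (\<Sum>k<n. w k * u (min q (R (Suc i) k - 1)) - w k * u (min q (R i k - 1)))"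
proof -
  obtain k where k: "k \<in> available I (S i)" "R i k \<le> q"
    using assms by (auto simp: level_break_def not_less)
  define j where "j = next_job b q0 I (S i)"
  have av: "available I (S i) \<noteq> {}"
    using k by auto
  have j: "j < n" "R i j \<le> q"
    using next_job[OF av] k unfolding j_def by (auto simp: available_def intro: order_trans)
  have "T (Suc i) - T i \<le> w j * b powi R i j"
    using step_probe(1)[OF consistent_S av] by (simp add: S_Suc j_def)
  also have "\<dots> = w j * u (min q (R (Suc i) j - 1)) - w j * u (min q (R i j - 1))"
    using R_Suc[OF j(1), of i] av j u_diff[of "R i j - 1"]
    by (simp add: j_def[symmetric] algebra_simps min_absorb2)
  also have "\<dots> = (\<Sum>k<n. if k = j then w j * u (min q (R (Suc i) j - 1)) - w j * u (min q (R i j - 1)) else 0)"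
    using j(1) by simp
  also have "\<dots> = (\<Sum>k<n. w k * u (min q (R (Suc i) k - 1)) - w k * u (min q (R i k - 1)))"
    by (rule sum.cong) (auto simp: R_Suc j_def)
  finally show ?thesis .
qed

text \<open>Telescoping \<open>clock_step_bound\<close> leaves one potential difference per job.
  Jobs that arrived before the break are done or have rank above \<open>q\<close>, and jobs not
  arrived before \<open>m\<close> still have rank \<open>q0\<close>, so both contribute nothing; the
  others contribute at most their work.\<close>

lemma block_clock_bound:
  assumes "level_break q i" "i \<le> m" and no_break: "\<And>x. i < x \<Longrightarrow> x \<le> m \<Longrightarrow> \<not> level_break q x"
  shows "T m \<le> T i + (\<Sum>k | k < n \<and> i \<le> arrival k \<and> arrival k < m. work q k)"
proof -
  define f where "f m k = w k * u (min q (R m k - 1))" for m k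
  have "T m - T i \<le> (\<Sum>k<n. f m k - f i k)"
    using assms(2) no_break
  proof (induction m rule: dec_induct)
    case (step m)
    have "T (Suc m) - T m \<le> (\<Sum>k<n. f (Suc m) k - f m k)"
      unfolding f_def using step by (intro clock_step_bound) auto
    then show ?case
      using step by (simp add: sum_subtractf)
  qed simp
  also have "\<dots> \<le> (\<Sum>k<n. if i \<le> arrival k \<and> arrival k < m then work q k else 0)"
  proof (rule sum_mono)
    fix k assume "k \<in> {..<n}"
    then have k: "k < n" by simp
    show "f m k - f i k \<le> (if i \<le> arrival k \<and> arrival k < m then work q k else 0)"
    proof (cases "arrival k < i")
      case True
      then have i: "i \<noteq> 0" "r k \<le> T (i - 1)"
        using arrival_le_iff[OF k, of "i - 1"] by auto
      have R: "R (i - 1) k \<le> R i k" "R i k \<le> R m k" "R m k \<le> final_rank k + 1"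
        using R_mono[OF _ k] R_le[OF k] assms(2) by auto
      \<comment> \<open>The break at \<open>i\<close> speaks about the jobs available in state
        \<open>i - 1\<close>, where \<open>k\<close> has already arrived.\<close>
      have "R (i - 1) k = final_rank k + 1 \<or> q < R (i - 1) k"
      proof (cases "completed (S (i - 1)) k = None")
        case True
        then show ?thesis
          using assms(1) i k by (auto simp: level_break_def available_def)
      next
        case False
        then show ?thesis
          using completed_iff[OF k, of "i - 1"] R_le[OF k, of "i - 1"] by auto
      qed
      then have "min q (R i k - 1) = min q (R m k - 1)"
        using R by linarith
      then show ?thesis
        using True by (simp add: f_def)
    next
      case False
      show ?thesis
      proof (cases "arrival k < m")
        case True
        have "f m k \<le> work q k"
          unfolding f_def work_def using R_le[OF k, of m] weight_pos[OF k] u_le_iff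
          by (intro mult_left_mono) auto
        moreover have "0 \<le> f i k"
          using u_pos weight_pos[OF k] by (simp add: f_def less_imp_le)
        ultimately show ?thesis
          using True False by simp
      next
        case False
        then have "R m k = q0" "R i k = q0"
          using R_before_arrival[OF k] assms(2) by auto
        then show ?thesis
          using False by (simp add: f_def)
      qed
    qed
  qed
  also have "\<dots> = (\<Sum>k | k < n \<and> i \<le> arrival k \<and> arrival k < m. work q k)"
    by (subst sum.inter_filter[symmetric]) (auto intro: sum.cong)
  finally show ?thesis by simp
qed

section \<open>The hierarchy of blocks\<close>

definition last_break :: "int \<Rightarrow> nat \<Rightarrow> nat" where
  "last_break q i = Max {x. x \<le> i \<and> level_break q x}"

lemma last_break_le: "last_break q i \<le> i" and level_break_last_break: "level_break q (last_break q i)"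
proof -
  have "last_break q i \<in> {x. x \<le> i \<and> level_break q x}"
    unfolding last_break_def by (rule Max_in) (auto simp: level_break_def)
  then show "last_break q i \<le> i" "level_break q (last_break q i)" by auto
qed

lemma le_last_break: "x \<le> i \<Longrightarrow> level_break q x \<Longrightarrow> x \<le> last_break q i"
  unfolding last_break_def by (rule Max_ge) auto

lemma last_break_eqI:
  assumes "x \<le> i" "level_break q x" "\<And>y. x < y \<Longrightarrow> y \<le> i \<Longrightarrow> \<not> level_break q y"
  shows "last_break q i = x"
  using assms last_break_le[of q i] level_break_last_break[of q i] le_last_break[of x i q]
  by (metis le_neq_implies_less)

lemma level_break_antimono: "level_break q' i \<Longrightarrow> q \<le> q' \<Longrightarrow> level_break q i"
  by (force simp: level_break_def)

text \<open>A break of level \<open>q'\<close> is also one of level \<open>q\<close>, so the latest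
  one up to \<open>i\<close> is not lost on passing to the latest break of level \<open>q\<close>.
  Blocks of different levels are therefore nested.\<close>

lemma last_break_last_break:
  assumes "q \<le> q'"
  shows "last_break q' (last_break q i) = last_break q' i"
  using assms last_break_le le_last_break level_break_last_break level_break_antimono
  by (intro antisym) (meson order_trans)+

definition block_start :: "int \<Rightarrow> nat \<Rightarrow> nat" where
  "block_start q k = last_break q (arrival k)"

definition block_end :: "int \<Rightarrow> nat \<Rightarrow> real" where
  "block_end q j = T (block_start q j) + (\<Sum>k | k < n \<and> block_start q k = block_start q j. work q k)"

text \<open>From arrival to completion \<open>j\<close> is available with rank at most its final
  rank, which excludes breaks of that level. The completion thus falls into the block of
  \<open>j\<close>, where \<open>block_clock_bound\<close> applies.\<close>

lemma completion_le_block_end: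
  assumes j: "j < n" and t: "completed (S m) j = Some t"
  shows "t \<le> block_end (final_rank j) j"
proof -
  let ?q = "final_rank j"
  obtain M where M: "completed (S (Suc M)) j = Some (T (Suc M))" "j \<in> available I (S M)"
    "\<And>i. i \<le> M \<Longrightarrow> completed (S i) j = None"
    using first_completed[OF j] by blast
  have no_break: "\<not> level_break ?q x" if "block_start ?q j < x" "x \<le> Suc M" for x
  proof (cases "x \<le> arrival j")
    case True
    then show ?thesis
      using that le_last_break[of x "arrival j" ?q] by (auto simp: block_start_def)
  next
    case False
    then have "j \<in> available I (S (x - 1))" "R (x - 1) j \<le> ?q" "x \<noteq> 0"
      using M(3)[of "x - 1"] that arrival_le_iff[OF j, of "x - 1"] completed_iff[OF j, of "x - 1"] j
      by (auto simp: available_def)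
    then show ?thesis
      by (auto simp: level_break_def not_less)
  qed
  have le: "block_start ?q j \<le> Suc M"
    using M(2) arrival_le_iff[OF j, of M] last_break_le[of ?q "arrival j"]
    by (simp add: block_start_def available_def)
  have "t = T (Suc M)"
    using completed_unique t M(1) by blast
  also have "\<dots> \<le> T (block_start ?q j) + (\<Sum>k | k < n \<and> block_start ?q j \<le> arrival k \<and> arrival k < Suc M. work ?q k)"
    using no_break le by (intro block_clock_bound) (auto simp: block_start_def level_break_last_break)
  also have "\<dots> \<le> block_end ?q j"
    unfolding block_end_def
  proof (intro add_left_mono sum_mono2 subsetI CollectI conjI)
    fix k assume "k \<in> {k. k < n \<and> block_start ?q j \<le> arrival k \<and> arrival k < Suc M}"
    then show "k < n" "block_start ?q k = block_start ?q j"
      using no_break level_break_last_break[of ?q "arrival j"]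
      by (auto simp: block_start_def[of _ k] block_start_def[of _ j] intro!: last_break_eqI)
  qed (auto simp: work_nonneg)
  finally show ?thesis .
qed

text \<open>The time from the start of the large block to that of the small one is paid by the jobs
  \<open>?A\<close> that arrive in between. The jobs \<open>?B\<close> of the small block are
  disjoint from these, and both sets belong to the large block.\<close>

lemma block_end_Suc:
  assumes j: "j < n"
  shows "T (block_start q j) + (\<Sum>k | k < n \<and> block_start q k = block_start q j. work (q + 1) k) \<le> block_end (q + 1) j"
proof -
  let ?i = "block_start (q + 1) j" and ?m = "block_start q j"
  let ?A = "{k. k < n \<and> ?i \<le> arrival k \<and> arrival k < ?m}" and ?B = "{k. k < n \<and> block_start q k = ?m}"
  have eq: "last_break (q + 1) ?m = ?i"
    by (simp add: block_start_def last_break_last_break)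
  have no_break: "\<not> level_break (q + 1) x" if "?i < x" "x \<le> ?m" for x
    using that le_last_break[of x ?m "q + 1"] eq by auto
  have "False" if "k \<in> ?A" "k \<in> ?B" for k
    using that last_break_le[of q "arrival k"] by (auto simp: block_start_def)
  then have disj: "?A \<inter> ?B = {}" by blast
  have level_break: "level_break (q + 1) ?i"
    by (simp add: block_start_def level_break_last_break)
  have "T ?m \<le> T ?i + (\<Sum>k\<in>?A. work (q + 1) k)"
    using no_break eq last_break_le[of "q + 1" ?m] level_break by (intro block_clock_bound) auto
  moreover have "(\<Sum>k\<in>?A. work (q + 1) k) + (\<Sum>k\<in>?B. work (q + 1) k) = (\<Sum>k\<in>?A \<union> ?B. work (q + 1) k)"
    using disj by (intro sum.union_disjoint[symmetric]) auto
  moreover have "\<dots> \<le> (\<Sum>k | k < n \<and> block_start (q + 1) k = ?i. work (q + 1) k)"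
  proof (intro sum_mono2 subsetI CollectI conjI)
    fix k assume k: "k \<in> ?A \<union> ?B"
    then show "k < n" by auto
    show "block_start (q + 1) k = ?i"
    proof (cases "k \<in> ?A")
      case True
      then show ?thesis
        unfolding block_start_def[of _ k] using no_break level_break by (intro last_break_eqI) auto
    next
      case False
      then show ?thesis
        using k last_break_last_break[of q "q + 1" "arrival k"] eq by (auto simp: block_start_def)
    qed
  qed (auto simp: work_nonneg)
  ultimately show ?thesis
    by (simp add: block_end_def)
qed

text \<open>A job waits for the end of the probing that runs at its release. As the probed job has
  already received all shorter probings, that probing is not longer than \<open>b - 1\<close> times the current
  time, up to a term that vanishes as \<open>q0\<close> decreases.\<close>

definition delay :: real where
  "delay = (\<Sum>k<n. w k) * b powi q0"

text \<open>An open job has failed in its probings of ranks \<open>q0\<close> to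
  \<open>R i k - 1\<close>, each at full length, and the geometric sum of these lengths fits into
  the elapsed time.\<close>

lemma spent_le_clock:
  assumes "k < n" "completed (S i) k = None"
  shows "w k * (b powi R i k - b powi q0) \<le> (b - 1) * T i"
  using assms(2)
proof (induction i)
  case 0
  then show ?case
    by (simp add: R_0) (simp add: S_0 init_state_def)
next
  case (Suc i)
  have None: "completed (S i) k = None"
    using Suc.prems completed_Suc_Some[of i k] by (cases "completed (S i) k") auto
  have Ti: "(b - 1) * T i \<le> (b - 1) * T (Suc i)"
    using T_mono[of i "Suc i"] b_gt_1 by simp
  show ?case
  proof (cases "available I (S i) \<noteq> {} \<and> k = next_job b q0 I (S i)")
    case True
    then have "completed (S (Suc i)) = (if final_rank k \<le> R i k
           then (completed (S i))(k \<mapsto> T (Suc i)) else completed (S i))"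
      using step_probe(3)[OF consistent_S[of i]] by (simp add: S_Suc)
    then have "\<not> final_rank k \<le> R i k"
      using Suc.prems by (auto split: if_splits)
    then have "T (Suc i) = T i + w k * b powi R i k"
      using step_probe(1)[OF consistent_S[of i]] True final_rank_le_iff[OF assms(1)]
      by (simp add: S_Suc)
    then show ?thesis
      using Suc.IH[OF None] R_Suc[OF assms(1), of i] True powi_Suc[of "R i k"]
      by (simp add: algebra_simps)
  next
    case False
    then show ?thesis
      using Suc.IH[OF None] R_Suc[OF assms(1), of i] Ti by auto
  qed
qed

lemma arrival_clock_le:
  assumes k: "k < n"
  shows "T (arrival k) \<le> b * r k + delay"
proof -
  have d: "w j * b powi q0 \<le> delay" if "j < n" for j
    unfolding delay_def using that powi_pos[of q0] weight_pos
    by (intro mult_right_mono member_le_sum) (auto simp: less_imp_le)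
  then have d0: "0 \<le> delay"
    using powi_pos[of q0] weight_pos k by (meson less_imp_le mult_nonneg_nonneg order_trans)
  have br: "r k \<le> b * r k"
    using b_gt_1 release_nonneg[OF k] by (simp add: mult_le_cancel_right1)
  show ?thesis
  proof (cases "arrival k")
    case 0
    then show ?thesis
      using d0 b_pos release_nonneg[OF k] by (simp add: S_0 init_state_def)
  next
    case (Suc i)
    have less: "T i < r k"
      using arrival_le_iff[OF k, of i] Suc by simp
    then have None: "completed (S i) k = None"
      using completed_iff[OF k, of i] R_before_arrival[OF k, of i] Suc q0_le[OF k] by simp
    show ?thesis
    proof (cases "available I (S i) = {}")
      case True
      then show ?thesis
        using idle_clock_ge(2)[OF True k None, of q0] d0 br Suc by (simp add: S_Suc)
    next
      case False
      define j where "j = next_job b q0 I (S i)"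
      have j: "j < n" "completed (S i) j = None"
        using next_job(1)[OF False] by (auto simp: j_def available_def)
      have "T (arrival k) \<le> T i + w j * b powi R i j"
        using step_probe(1)[OF consistent_S False] Suc by (simp add: S_Suc j_def)
      \<comment> \<open>The probed job \<open>j\<close> is open, so \<open>spent_le_clock\<close>
        bounds its probing by \<open>(b - 1) * T i\<close> plus its first probing time. The probing
        began before the release of \<open>k\<close>.\<close>
      also have "\<dots> \<le> b * T i + w j * b powi q0"
        using spent_le_clock[OF j] by (simp add: algebra_simps)
      also have "\<dots> \<le> b * r k + delay"
        using less d[OF j(1)] b_pos by (intro add_mono) auto
      finally show ?thesis .
    qed
  qed
qed

lemma block_start_le:
  assumes "j < n" "k < n" "block_start q k = block_start q j"
  shows "T (block_start q j) \<le> b * r k + delay"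
  using arrival_clock_le[OF assms(2)] T_mono[OF last_break_le[of q "arrival k"]] assms(3)
  by (simp add: block_start_def)

end

section \<open>Comparison with a preemptive schedule\<close>

context scaling_run
begin

definition size_bound :: "nat \<Rightarrow> real" where
  "size_bound j = w j * u (final_rank j)"

definition finishing :: "int \<Rightarrow> nat set" where
  "finishing q = {j. j < n \<and> final_rank j \<le> q}"

lemma finite_finishing: "finite (finishing q)"
  by (simp add: finishing_def)

lemma size_bound_nonneg: "j < n \<Longrightarrow> 0 \<le> size_bound j"
  using u_pos weight_pos by (simp add: size_bound_def less_imp_le)

text \<open>The probing one rank below the final one is too short for \<open>j\<close>, and the
  geometric series up to the final rank is \<open>b^2 / (b - 1)\<close> times as long as that
  probing.\<close>

lemma size_bound_le:
  assumes "j < n"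
  shows "size_bound j \<le> b\<^sup>2 / (b - 1) * p j"
proof -
  have "b powi (final_rank j + 1) = b\<^sup>2 * b powi (final_rank j - 1)"
    using powi_Suc[of "final_rank j"] powi_Suc[of "final_rank j - 1"] by (simp add: power2_eq_square)
  then have "size_bound j = b\<^sup>2 / (b - 1) * (w j * b powi (final_rank j - 1))"
    by (simp add: size_bound_def u_def)
  also have "\<dots> \<le> b\<^sup>2 / (b - 1) * p j"
    using proc_gt[OF assms] b_gt_1 by (intro mult_left_mono) auto
  finally show ?thesis .
qed

definition finishing_load :: "int \<Rightarrow> nat \<Rightarrow> real" where
  "finishing_load q j = (\<Sum>k | k \<in> finishing q \<and> block_start q k = block_start q j. size_bound k)"

text \<open>Between the levels \<open>q\<close> and \<open>q + 1\<close> the work of jobs with final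
  rank at most \<open>q\<close> is unchanged, while that of the others is proportional to
  \<open>u\<close>.\<close>

lemma block_work:
  fixes q :: int and j :: nat
  defines "h \<equiv> \<Sum>k | k < n \<and> block_start q k = block_start q j \<and> q < final_rank k. w k"
  shows "(\<Sum>k | k < n \<and> block_start q k = block_start q j. work q k) = finishing_load q j + u q * h"
    and "(\<Sum>k | k < n \<and> block_start q k = block_start q j. work (q + 1) k) = finishing_load q j + u (q + 1) * h"
proof -
  let ?G = "{k. k < n \<and> block_start q k = block_start q j}"
  let ?L = "{k. k \<in> finishing q \<and> block_start q k = block_start q j}"
  let ?H = "{k. k < n \<and> block_start q k = block_start q j \<and> q < final_rank k}"
  have split: "(\<Sum>k\<in>?G. f k) = (\<Sum>k\<in>?L. f k) + (\<Sum>k\<in>?H. f k)" for f :: "nat \<Rightarrow> real"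
    by (subst sum.union_disjoint[symmetric]) (auto simp: finishing_def intro: sum.cong)
  have "(\<Sum>k\<in>?L. work q k) = finishing_load q j" "(\<Sum>k\<in>?L. work (q + 1) k) = finishing_load q j"
    by (auto simp: finishing_load_def finishing_def work_def size_bound_def min_absorb2 intro!: sum.cong)
  moreover have "(\<Sum>k\<in>?H. work q k) = u q * h" "(\<Sum>k\<in>?H. work (q + 1) k) = u (q + 1) * h"
    by (auto simp: h_def sum_distrib_left work_def min_absorb1 intro!: sum.cong)
  ultimately show "(\<Sum>k\<in>?G. work q k) = finishing_load q j + u q * h"
    "(\<Sum>k\<in>?G. work (q + 1) k) = finishing_load q j + u (q + 1) * h"
    by (simp_all add: split)
qed

text \<open>After division by \<open>u\<close> the jobs of higher final rank contribute the same
  \<open>h\<close> on both levels and cancel; only the start time and the finishing load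
  remain.\<close>

lemma block_end_step:
  assumes "j < n"
  shows "block_end q j / u q - block_end (q + 1) j / u (q + 1)
         \<le> (1 / u q - 1 / u (q + 1)) * (T (block_start q j) + finishing_load q j)"
proof -
  define h where "h = (\<Sum>k | k < n \<and> block_start q k = block_start q j \<and> q < final_rank k. w k)"
  have "block_end q j = T (block_start q j) + finishing_load q j + u q * h"
    by (simp add: block_end_def block_work h_def)
  moreover have "T (block_start q j) + finishing_load q j + u (q + 1) * h \<le> block_end (q + 1) j"
    using block_end_Suc[OF assms, of q] by (simp add: block_work h_def)
  then have "(T (block_start q j) + finishing_load q j + u (q + 1) * h) / u (q + 1) \<le> block_end (q + 1) j / u (q + 1)"
    using u_pos by (simp add: divide_right_mono less_imp_le)
  ultimately show ?thesis
    using u_pos[of q] u_pos[of "q + 1"] by (simp add: add_divide_distrib algebra_simps)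
qed

context
  fixes \<sigma> :: "real \<Rightarrow> nat option"
  assumes \<sigma>: "preemptive_schedule I \<sigma>"
begin

definition C :: "nat \<Rightarrow> real" where
  "C j = preemptive_completion I \<sigma> j + delay"

text \<open>The blocks of level \<open>q\<close> partition the finishing jobs.
  \<open>block_lower_bound\<close> applies to each block because none of its jobs has an effective
  release date before the block start.\<close>

lemma level_bound:
  "(\<Sum>j\<in>finishing q. size_bound j * (T (block_start q j) + finishing_load q j))
   \<le> 2 * (b\<^sup>2 / (b - 1)) * (\<Sum>j\<in>finishing q. size_bound j * C j)"
proof -
  define G where "G y = {j \<in> finishing q. block_start q j = y}" for y
  have b: "1 \<le> b" "b \<le> b\<^sup>2 / (b - 1)" "0 \<le> delay"
    using b_gt_1 powi_pos[of q0] weight_pos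
    by (auto simp: field_simps power2_eq_square delay_def less_imp_le intro!: mult_nonneg_nonneg sum_nonneg)
  have "(\<Sum>j\<in>G y. size_bound j * (T (block_start q j) + finishing_load q j))
    \<le> 2 * (b\<^sup>2 / (b - 1)) * (\<Sum>j\<in>G y. size_bound j * C j)" for y
  proof -
    have "T y \<le> b * r k + delay" if "k \<in> G y" for k
      using that block_start_le[of k k q] by (auto simp: G_def finishing_def)
    then have "(\<Sum>j\<in>G y. size_bound j * (T y + (\<Sum>k\<in>G y. size_bound k)))
      \<le> 2 * (b\<^sup>2 / (b - 1)) * (\<Sum>j\<in>G y. size_bound j * C j)"
      unfolding C_def using b T_nonneg size_bound_nonneg size_bound_le
      by (intro block_lower_bound[OF valid \<sigma>]) (auto simp: G_def finishing_def)
    moreover have "(\<Sum>j\<in>G y. size_bound j * (T (block_start q j) + finishing_load q j))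
      = (\<Sum>j\<in>G y. size_bound j * (T y + (\<Sum>k\<in>G y. size_bound k)))"
      by (rule sum.cong) (auto simp: G_def finishing_load_def)
    ultimately show ?thesis by simp
  qed
  then have "(\<Sum>y\<in>block_start q ` finishing q. \<Sum>j\<in>G y. size_bound j * (T (block_start q j) + finishing_load q j))
    \<le> 2 * (b\<^sup>2 / (b - 1)) * (\<Sum>y\<in>block_start q ` finishing q. \<Sum>j\<in>G y. size_bound j * C j)"
    unfolding sum_distrib_left[of _ _ "block_start q ` _"] by (intro sum_mono)
  then show ?thesis
    unfolding G_def sum.image_gen[OF finite_finishing, of _ _ "block_start q", symmetric] .
qed

text \<open>Summation by parts as an induction. A share \<open>1 - u (final_rank j) / u q\<close> of
  each job is already compared with the schedule; the last sum holds the remaining share, still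
  charged at the block end of level \<open>q\<close>.\<close>

lemma level_induction:
  assumes "q0 - 1 \<le> q"
  shows "(\<Sum>j\<in>finishing q. w j * block_end (final_rank j) j)
         \<le> 2 * (b\<^sup>2 / (b - 1)) * (\<Sum>j\<in>finishing q. w j * C j * (1 - u (final_rank j) / u q))
           + (\<Sum>j\<in>finishing q. size_bound j * (block_end q j / u q))"
  using assms
proof (induction q rule: int_ge_induct)
  case base
  have "finishing (q0 - 1) = {}"
    using q0_le by (force simp: finishing_def)
  then show ?case by simp
next
  case (step q)
  let ?c = "b\<^sup>2 / (b - 1)"
  define N where "N = {j. j < n \<and> final_rank j = q + 1}"
  have un: "finishing (q + 1) = finishing q \<union> N" "finishing q \<inter> N = {}" "finite N"
    by (auto simp: finishing_def N_def)
  have split: "sum f (finishing (q + 1)) = sum f (finishing q) + sum f N" for f :: "nat \<Rightarrow> real"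
    unfolding un(1) using un finite_finishing by (intro sum.union_disjoint) auto
  \<comment> \<open>New jobs enter with settled share 0, because
    \<open>size_bound j / u (q + 1) = w j\<close> for them.\<close>
  have N: "(\<Sum>j\<in>N. w j * block_end (final_rank j) j) =
      2 * ?c * (\<Sum>j\<in>N. w j * C j * (1 - u (final_rank j) / u (q + 1)))
      + (\<Sum>j\<in>N. size_bound j * (block_end (q + 1) j / u (q + 1)))"
    using u_pos[of "q + 1"] by (simp add: N_def size_bound_def)
  have "(\<Sum>j\<in>finishing q. size_bound j * (block_end q j / u q))
      - (\<Sum>j\<in>finishing q. size_bound j * (block_end (q + 1) j / u (q + 1)))
      = (\<Sum>j\<in>finishing q. size_bound j * (block_end q j / u q - block_end (q + 1) j / u (q + 1)))"
    by (simp add: right_diff_distrib sum_subtractf)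
  also have "\<dots> \<le> (\<Sum>j\<in>finishing q. size_bound j *
      ((1 / u q - 1 / u (q + 1)) * (T (block_start q j) + finishing_load q j)))"
    using block_end_step size_bound_nonneg by (intro sum_mono mult_left_mono) (auto simp: finishing_def)
  also have "\<dots> = (1 / u q - 1 / u (q + 1)) *
      (\<Sum>j\<in>finishing q. size_bound j * (T (block_start q j) + finishing_load q j))"
    by (simp add: sum_distrib_left mult_ac)
  also have "\<dots> \<le> (1 / u q - 1 / u (q + 1)) * (2 * ?c * (\<Sum>j\<in>finishing q. size_bound j * C j))"
    using u_pos[of q] u_le_iff[of q "q + 1"]
    by (intro mult_left_mono level_bound) (simp add: frac_le)
  also have "\<dots> = 2 * ?c * ((1 / u q - 1 / u (q + 1)) * (\<Sum>j\<in>finishing q. size_bound j * C j))"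
    by (simp only: mult_ac)
  \<comment> \<open>This is the growth of the settled share from level \<open>q\<close> to level
    \<open>q + 1\<close>.\<close>
  also have "(1 / u q - 1 / u (q + 1)) * (\<Sum>j\<in>finishing q. size_bound j * C j)
      = (\<Sum>j\<in>finishing q. w j * C j * (1 - u (final_rank j) / u (q + 1)))
      - (\<Sum>j\<in>finishing q. w j * C j * (1 - u (final_rank j) / u q))"
    by (simp add: sum_subtractf[symmetric] sum_distrib_left size_bound_def algebra_simps)
  finally show ?case
    using step.IH by (simp add: split N right_diff_distrib distrib_left)
qed

text \<open>On the top level every job is finishing, so \<open>level_bound\<close> also settles the
  remaining share, and the two shares add up to 1.\<close>

lemma cost_bound:
  assumes "\<And>j. j < n \<Longrightarrow> \<exists>m. completed (S m) j = Some (t j)"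
  shows "(\<Sum>j<n. w j * t j) \<le> 2 * (b\<^sup>2 / (b - 1)) * (\<Sum>j<n. w j * (preemptive_completion I \<sigma> j + delay))"
proof -
  let ?c = "b\<^sup>2 / (b - 1)"
  \<comment> \<open>\<open>insert q0\<close> provides a maximum for an instance without jobs and
    places \<open>q\<close> above the base of the induction.\<close>
  define q where "q = Max (insert q0 (final_rank ` {..<n}))"
  have q: "final_rank j \<le> q" if "j < n" for j
    unfolding q_def using that by (intro Max_ge) auto
  then have fin: "finishing q = {..<n}"
    by (auto simp: finishing_def)
  have "q0 - 1 \<le> q"
    unfolding q_def by (rule order_trans[of _ q0]) auto
  have block_end: "block_end q j = T (block_start q j) + finishing_load q j" for j
    unfolding block_end_def finishing_load_def fin
    using q by (auto simp: work_def size_bound_def min_absorb2 intro!: sum.cong)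
  have "(\<Sum>j<n. w j * t j) \<le> (\<Sum>j<n. w j * block_end (final_rank j) j)"
    using assms completion_le_block_end weight_pos by (intro sum_mono mult_left_mono) (auto simp: less_imp_le)
  also have "\<dots> \<le> 2 * ?c * (\<Sum>j<n. w j * C j * (1 - u (final_rank j) / u q))
           + (\<Sum>j<n. size_bound j * (block_end q j / u q))"
    using level_induction[OF \<open>q0 - 1 \<le> q\<close>] by (simp only: fin)
  also have "(\<Sum>j<n. size_bound j * (block_end q j / u q))
      = (\<Sum>j<n. size_bound j * (T (block_start q j) + finishing_load q j)) / u q"
    by (simp add: block_end sum_divide_distrib)
  also have "\<dots> \<le> 2 * ?c * (\<Sum>j<n. size_bound j * C j) / u q"
    using level_bound[of q] u_pos[of q] unfolding fin by (intro divide_right_mono) auto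
  also have "2 * ?c * (\<Sum>j<n. w j * C j * (1 - u (final_rank j) / u q))
      + 2 * ?c * (\<Sum>j<n. size_bound j * C j) / u q = 2 * ?c * (\<Sum>j<n. w j * C j)"
    by (simp add: sum.distrib[symmetric] sum_distrib_left sum_divide_distrib size_bound_def algebra_simps)
  finally show ?thesis
    by (simp add: C_def)
qed

end

end

section \<open>Convergence as the initial rank decreases\<close>

context scaling_setting
begin

lemma powi_tendsto_0: "((\<lambda>q. b powi q) \<longlongrightarrow> 0) at_bot"
proof (rule tendstoI)
  fix e :: real assume "0 < e"
  have "b powi q < e" if "q \<le> \<lfloor>log b e\<rfloor> - 1" for q
  proof -
    have "real_of_int q < log b e"
      using that by linarith
    then have "b powr real_of_int q < e"
      using b_gt_1 \<open>0 < e\<close> by (simp add: powr_less_iff)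
    then show ?thesis
      using b_pos by (simp add: powr_real_of_int')
  qed
  then have "dist (b powi q) 0 < e" if "q \<le> \<lfloor>log b e\<rfloor> - 1" for q
    using that powi_pos[of q] by (simp add: dist_real_def)
  then show "\<forall>\<^sub>F q in at_bot. dist (b powi q) 0 < e"
    by (rule eventually_mono[OF eventually_le_at_bot])
qed

lemma eventually_less:
  assumes "x < y"
  shows "\<forall>\<^sub>F q in at_bot. x + z * b powi q < y"
proof -
  have "((\<lambda>q. x + z * b powi q) \<longlongrightarrow> x + z * 0) at_bot"
    by (intro tendsto_intros powi_tendsto_0)
  then show ?thesis
    using order_tendstoD(2)[of _ "x + z * 0"] assms by simp
qed

lemma eventually_le_const: "\<forall>\<^sub>F q in at_bot. q + (i::int) \<le> k"
  unfolding eventually_at_bot_linorder by (rule exI[of _ "k - i"]) auto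

text \<open>Induction on the total rank deficit of \<open>X\<close>. Each step probes a job of
  \<open>X\<close>, which fails because its rank is below \<open>Q\<close>, and no release
  interferes. The predicted end of the phase is therefore invariant, whatever the order of the
  probings.\<close>

lemma rank_phase:
  assumes "consistent q0 s" "X \<subseteq> available I s"
    and "\<And>i. i \<in> X \<Longrightarrow> rk q0 s i \<le> Q"
    and "\<And>i. i \<in> available I s \<Longrightarrow> i \<notin> X \<Longrightarrow> Q \<le> rk q0 s i"
    and "\<And>i. i \<in> X \<Longrightarrow> Q \<le> final_rank i"
    and "\<And>j. j < n \<Longrightarrow> clock s < r j \<Longrightarrow>
           clock s + (\<Sum>i\<in>X. w i * (b powi Q - b powi rk q0 s i) / (b - 1)) < r j"
  shows "\<exists>m. let s' = (scaling_step b q0 I ^^ m) s in consistent q0 s' \<and>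
           clock s' = clock s + (\<Sum>i\<in>X. w i * (b powi Q - b powi rk q0 s i) / (b - 1)) \<and>
           (\<forall>i<n. rk q0 s' i = (if i \<in> X then Q else rk q0 s i)) \<and> completed s' = completed s"
  using assms
proof (induction "nat (\<Sum>i\<in>X. Q - rk q0 s i)" arbitrary: s rule: less_induct)
  case less
  have X: "finite X" "\<And>i. i \<in> X \<Longrightarrow> i < n"
    using less.prems(2) finite_subset[OF _ finite_available] by (auto simp: available_def)
  show ?case
  proof (cases "\<forall>i\<in>X. rk q0 s i = Q")
    case True
    then show ?thesis
      using less.prems(1) by (intro exI[of _ 0]) simp
  next
    case False
    then obtain i where i: "i \<in> X" "rk q0 s i < Q"
      using less.prems(3) by force
    have av: "available I s \<noteq> {}"
      using i less.prems(2) by auto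
    define j where "j = next_job b q0 I s"
    define s' where "s' = scaling_step b q0 I s"
    have jQ: "rk q0 s j < Q"
      using next_job(2)[OF av, of i q0] i less.prems(2) by (auto simp: j_def)
    then have jX: "j \<in> X"
      using next_job(1)[OF av, of q0] less.prems(4)[of j] by (auto simp: j_def)
    then have jn: "j < n" and jf: "\<not> final_rank j \<le> rk q0 s j"
      using X less.prems(5) jQ by force+
    note s' = step_probe[OF less.prems(1) av, folded j_def s'_def]
    have clock': "clock s' = clock s + w j * b powi rk q0 s j"
      using s'(1) jf final_rank_le_iff[OF jn] by auto
    have rk': "k < n \<Longrightarrow> rk q0 s' k = (if k = j then rk q0 s j + 1 else rk q0 s k)" for k
      by (rule s'(2))
    have co': "completed s' = completed s"
      using s'(3) jf by simp
    let ?f = "\<lambda>s i. w i * (b powi Q - b powi rk q0 s i) / (b - 1)"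
    have "?f s j = ?f s' j + w j * b powi rk q0 s j"
      using b_gt_1 rk'[OF jn] powi_Suc[of "rk q0 s j"] by (simp add: field_simps)
    moreover have "(\<Sum>i\<in>X - {j}. ?f s i) = (\<Sum>i\<in>X - {j}. ?f s' i)"
      using X rk' by (intro sum.cong) auto
    ultimately have f: "clock s' + (\<Sum>i\<in>X. ?f s' i) = clock s + (\<Sum>i\<in>X. ?f s i)"
      using clock' by (simp add: sum.remove[OF X(1) jX])
    have le': "rk q0 s' i \<le> Q" if "i \<in> X" for i
      using that rk' X jQ less.prems(3) by auto
    have "0 \<le> ?f s' i" if "i \<in> X" for i
      using le'[OF that] X(2)[OF that] weight_pos powi_le_iff b_gt_1
      by (intro divide_nonneg_nonneg mult_nonneg_nonneg) (auto simp: less_imp_le)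
    then have "0 \<le> (\<Sum>i\<in>X. ?f s' i)"
      by (rule sum_nonneg)
    then have clock_le: "clock s \<le> clock s'" and "clock s' \<le> clock s + (\<Sum>i\<in>X. ?f s i)"
      using f clock' powi_pos[of "rk q0 s j"] weight_pos[OF jn] by (auto simp: less_imp_le)
    then have rel: "r k \<le> clock s' \<longleftrightarrow> r k \<le> clock s" if "k < n" for k
      using less.prems(6)[OF that] by (smt (verit))
    have av': "available I s' = available I s"
      using rel by (auto simp: available_def co')
    have "(\<Sum>i\<in>X. Q - rk q0 s' i) < (\<Sum>i\<in>X. Q - rk q0 s i)"
      using X jX rk' by (intro sum_strict_mono_ex1) auto
    moreover have "0 \<le> (\<Sum>i\<in>X. Q - rk q0 s' i)"
      using le' by (intro sum_nonneg) auto
    ultimately have dec: "nat (\<Sum>i\<in>X. Q - rk q0 s' i) < nat (\<Sum>i\<in>X. Q - rk q0 s i)"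
      by linarith
    have "\<exists>m. let s'' = (scaling_step b q0 I ^^ m) s' in consistent q0 s'' \<and>
           clock s'' = clock s' + (\<Sum>i\<in>X. ?f s' i) \<and>
           (\<forall>i<n. rk q0 s'' i = (if i \<in> X then Q else rk q0 s' i)) \<and> completed s'' = completed s'"
    proof (rule less.hyps[OF dec])
      show "Q \<le> rk q0 s' i" if "i \<in> available I s'" "i \<notin> X" for i
        using that less.prems(4)[of i] rk'[of i] jX by (auto simp: av') (auto simp: available_def)
      show "clock s' + (\<Sum>i\<in>X. ?f s' i) < r k" if "k < n" "clock s' < r k" for k
        using that less.prems(6)[of k] clock_le by (simp add: f)
    qed (use s'(4) less.prems av' le' in auto)
    then obtain m where "let s'' = (scaling_step b q0 I ^^ m) s' in consistent q0 s'' \<and>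
           clock s'' = clock s' + (\<Sum>i\<in>X. ?f s' i) \<and>
           (\<forall>i<n. rk q0 s'' i = (if i \<in> X then Q else rk q0 s' i)) \<and> completed s'' = completed s'"
      by blast
    then show ?thesis
      using f co' rk' jX
      by (intro exI[of _ "Suc m"]) (auto simp: funpow_Suc_right s'_def[symmetric] Let_def simp del: funpow.simps)
  qed
qed

end

text \<open>A family of states, one for each small initial rank \<open>q0\<close>. Clock and completion times are
  affine functions of \<open>b powi q0\<close>, given by constant term and slope. The ranks of vanishing jobs are
  relative to \<open>q0\<close>, the other ranks are absolute.\<close>

record state_family =
  base :: real
  slope :: real
  vanishing :: "nat set"
  offset :: "nat \<Rightarrow> int"
  finished :: "nat \<Rightarrow> (real \<times> real) option"

context scaling_setting
begin

definition family_rank :: "state_family \<Rightarrow> int \<Rightarrow> nat \<Rightarrow> int" where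
  "family_rank F q0 j = (if j \<in> vanishing F then q0 + offset F j else offset F j)"

definition member :: "state_family \<Rightarrow> int \<Rightarrow> exec_state \<Rightarrow> bool" where
  "member F q0 s \<longleftrightarrow> consistent q0 s \<and> clock s = base F + slope F * b powi q0 \<and>
     (\<forall>j<n. rk q0 s j = family_rank F q0 j) \<and>
     (\<forall>j<n. completed s j = map_option (\<lambda>(x, y). x + y * b powi q0) (finished F j))"

text \<open>The number of steps may depend on \<open>q0\<close>. Nonnegative offsets say that
  vanishing ranks never fall below \<open>q0\<close>; a vanishing probing then raises the slope by
  at least the weight of its job.\<close>

definition reached :: "state_family \<Rightarrow> bool" where
  "reached F \<longleftrightarrow> (\<forall>j\<in>vanishing F. 0 \<le> offset F j) \<and>
     (\<forall>\<^sub>F q0 in at_bot. \<exists>m. member F q0 ((scaling_step b q0 I ^^ m) init_state))"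

text \<open>Comparison with the clock for all small \<open>q0\<close>: if the constant terms agree,
  the sign of the slope decides, and a negative slope puts the clock just before the
  release.\<close>

definition released :: "state_family \<Rightarrow> nat \<Rightarrow> bool" where
  "released F j \<longleftrightarrow> r j < base F \<or> (r j = base F \<and> 0 \<le> slope F)"

definition ready :: "state_family \<Rightarrow> nat set" where
  "ready F = {j. j < n \<and> released F j \<and> finished F j = None}"

lemma finite_ready: "finite (ready F)"
  by (simp add: ready_def)

lemma eventually_released:
  "\<forall>\<^sub>F q0 in at_bot. \<forall>j<n. r j \<le> base F + slope F * b powi q0 \<longleftrightarrow> released F j"
proof -
  have "\<forall>\<^sub>F q0 in at_bot. r j \<le> base F + slope F * b powi q0 \<longleftrightarrow> released F j" for j
  proof (cases "r j" "base F" rule: linorder_cases)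
    case less
    have "\<forall>\<^sub>F q0 in at_bot. - base F + (- slope F) * b powi q0 < - r j"
      using less by (intro eventually_less) simp
    then show ?thesis
      by eventually_elim (use less in \<open>auto simp: released_def\<close>)
  next
    case equal
    have "0 \<le> slope F * b powi q \<longleftrightarrow> 0 \<le> slope F" for q
      using powi_pos[of q] by (auto simp: zero_le_mult_iff)
    with equal show ?thesis
      by (simp add: released_def)
  next
    case greater
    then have "\<forall>\<^sub>F q0 in at_bot. base F + slope F * b powi q0 < r j"
      by (intro eventually_less)
    then show ?thesis
      by eventually_elim (use greater in \<open>auto simp: released_def\<close>)
  qed
  then have "\<forall>\<^sub>F q0 in at_bot. \<forall>j\<in>{..<n}. r j \<le> base F + slope F * b powi q0 \<longleftrightarrow> released F j"
    by (intro eventually_ball_finite) auto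
  then show ?thesis
    by (simp only: Ball_def lessThan_iff)
qed

lemma available_member:
  assumes "member F q0 s" "\<forall>j<n. r j \<le> base F + slope F * b powi q0 \<longleftrightarrow> released F j"
  shows "available I s = ready F"
  using assms by (auto simp: member_def available_def ready_def)

text \<open>Executions are concatenated: it suffices to lead from the members of \<open>F\<close> to
  members of \<open>F'\<close> for all small \<open>q0\<close>.\<close>

lemma reachedI:
  assumes F: "reached F" and off: "\<And>j. j \<in> vanishing F' \<Longrightarrow> 0 \<le> offset F' j"
    and ev: "\<forall>\<^sub>F q0 in at_bot. \<forall>s. member F q0 s \<longrightarrow> available I s = ready F \<longrightarrow>
               (\<exists>m. member F' q0 ((scaling_step b q0 I ^^ m) s))"
  shows "reached F'"
proof -
  have "\<forall>\<^sub>F q0 in at_bot. \<exists>m. member F q0 ((scaling_step b q0 I ^^ m) init_state)"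
    using F by (simp add: reached_def)
  then have "\<forall>\<^sub>F q0 in at_bot. \<exists>m. member F' q0 ((scaling_step b q0 I ^^ m) init_state)"
    using ev eventually_released[of F]
  proof eventually_elim
    case (elim q0)
    then obtain m where m: "member F q0 ((scaling_step b q0 I ^^ m) init_state)" by blast
    then have "available I ((scaling_step b q0 I ^^ m) init_state) = ready F"
      using available_member elim(3) by blast
    then obtain k where "member F' q0 ((scaling_step b q0 I ^^ k) ((scaling_step b q0 I ^^ m) init_state))"
      using elim(2) m by blast
    then show ?case
      by (intro exI[of _ "k + m"]) (simp add: funpow_add)
  qed
  then show ?thesis
    using off by (simp add: reached_def)
qed

lemma reached_offset_le:
  assumes "reached F" "j \<in> ready F" "j \<notin> vanishing F"
  shows "offset F j \<le> final_rank j"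
proof -
  have "\<exists>q0 s. member F q0 s"
    using assms(1) eventually_happens[of _ "at_bot :: int filter"] by (fastforce simp: reached_def)
  then show ?thesis
    using assms(2,3) by (auto simp: member_def consistent_def ready_def family_rank_def)
qed

section \<open>Transitions between state families\<close>

lemma idle_family:
  assumes F: "reached F" and A: "ready F = {}" and j: "j < n" "finished F j = None"
  shows "reached (F\<lparr>base := Min (r ` {j. j < n \<and> finished F j = None}), slope := 0\<rparr>)"
proof (rule reachedI[OF F])
  let ?F' = "F\<lparr>base := Min (r ` {j. j < n \<and> finished F j = None}), slope := 0\<rparr>"
  show "\<forall>\<^sub>F q0 in at_bot. \<forall>s. member F q0 s \<longrightarrow> available I s = ready F \<longrightarrow>
               (\<exists>m. member ?F' q0 ((scaling_step b q0 I ^^ m) s))"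
  proof (intro always_eventually allI impI)
    fix q0 s assume s: "member F q0 s" "available I s = ready F"
    then have av: "available I s = {}" "completed s j = None"
      using A j by (auto simp: member_def)
    note step = step_idle[OF av(1) j(1) av(2), of q0]
    have "{j. j < n \<and> completed s j = None} = {j. j < n \<and> finished F j = None}"
      using s(1) by (auto simp: member_def)
    then have "member ?F' q0 (scaling_step b q0 I s)"
      using s(1) step step_consistent by (simp add: member_def family_rank_def)
    then show "\<exists>m. member ?F' q0 ((scaling_step b q0 I ^^ m) s)"
      by (intro exI[of _ 1]) simp
  qed
qed (use F in \<open>auto simp: reached_def\<close>)

lemma next_job_eqI:
  assumes "j \<in> available I s"
    and "\<And>i. i \<in> available I s \<Longrightarrow> rk q0 s j < rk q0 s i \<or> rk q0 s j = rk q0 s i \<and> j \<le> i"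
  shows "next_job b q0 I s = j"
  unfolding next_job_def using assms by (intro Least_equality) force+

lemma lex_min_exists:
  fixes f :: "nat \<Rightarrow> int"
  assumes "finite X" "X \<noteq> {}"
  obtains j where "j \<in> X" "\<And>i. i \<in> X \<Longrightarrow> f j < f i \<or> f j = f i \<and> j \<le> i"
proof -
  define m where "m = Min (f ` X)"
  have m: "m \<in> f ` X" "\<And>i. i \<in> X \<Longrightarrow> m \<le> f i"
    using assms by (auto simp: m_def)
  let ?Y = "{i \<in> X. f i = m}"
  have "?Y \<noteq> {}" "finite ?Y"
    using m assms by auto
  then have "Min ?Y \<in> ?Y" "\<And>i. i \<in> ?Y \<Longrightarrow> Min ?Y \<le> i"
    using Min_in by blast (use \<open>finite ?Y\<close> in auto)
  then show thesis
    using m(2) by (intro that[of "Min ?Y"]) (auto simp: order_le_less)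
qed

text \<open>For small \<open>q0\<close> the vanishing ranks lie below all absolute ones and are
  ordered by their offsets, so the same job is chosen throughout. Its probing time is a multiple of
  \<open>b powi q0\<close> and changes only the slope.\<close>

lemma vanishing_family:
  assumes F: "reached F" and A: "ready F \<inter> vanishing F \<noteq> {}"
  obtains j where "j \<in> ready F \<inter> vanishing F"
    "reached (F\<lparr>slope := slope F + w j * b powi offset F j, offset := (offset F)(j := offset F j + 1)\<rparr>)"
proof -
  obtain j where j: "j \<in> ready F \<inter> vanishing F" and
    min: "\<And>i. i \<in> ready F \<inter> vanishing F \<Longrightarrow> offset F j < offset F i \<or> offset F j = offset F i \<and> j \<le> i"
    using lex_min_exists[OF _ A] finite_ready by blast
  then have jn: "j < n" by (simp add: ready_def)
  let ?F' = "F\<lparr>slope := slope F + w j * b powi offset F j, offset := (offset F)(j := offset F j + 1)\<rparr>"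
  have "reached ?F'"
  proof (rule reachedI[OF F])
    have "\<forall>\<^sub>F q0 in at_bot. \<forall>i\<in>ready F. q0 + (offset F j + 1) \<le> offset F i"
      by (intro eventually_ball_finite finite_ready ballI eventually_le_const)
    moreover have "\<forall>\<^sub>F q0 in at_bot. q0 + (offset F j + 1) \<le> final_rank j"
      by (rule eventually_le_const)
    ultimately show "\<forall>\<^sub>F q0 in at_bot. \<forall>s. member F q0 s \<longrightarrow> available I s = ready F \<longrightarrow>
               (\<exists>m. member ?F' q0 ((scaling_step b q0 I ^^ m) s))"
    proof eventually_elim
      case (elim q0)
      show ?case
      proof (intro allI impI)
      fix s assume "member F q0 s" "available I s = ready F"
      note elim = elim this
      then have s: "consistent q0 s" "clock s = base F + slope F * b powi q0"
        "\<And>i. i < n \<Longrightarrow> rk q0 s i = family_rank F q0 i"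
        by (auto simp: member_def)
      have rj: "rk q0 s j = q0 + offset F j"
        using s(3)[OF jn] j by (simp add: family_rank_def)
      have nj: "next_job b q0 I s = j"
      proof (rule next_job_eqI)
        fix i assume "i \<in> available I s"
        then show "rk q0 s j < rk q0 s i \<or> rk q0 s j = rk q0 s i \<and> j \<le> i"
          using elim min[of i] s(3)[of i] rj by (force simp: family_rank_def ready_def)
      qed (use elim j in auto)
      have av: "available I s \<noteq> {}"
        using elim j by auto
      note step = step_probe[OF s(1) av, unfolded nj]
      have nf: "\<not> final_rank j \<le> rk q0 s j"
        using elim rj by simp
      have "b powi rk q0 s j = b powi offset F j * b powi q0"
        using b_nonzero by (simp add: rj power_int_add mult.commute)
      then have "clock (scaling_step b q0 I s) = clock s + w j * (b powi offset F j * b powi q0)"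
        using step(1) nf final_rank_le_iff[OF jn] by auto
      then have "member ?F' q0 (scaling_step b q0 I s)"
        using elim(3) step(2,3,4) s nf j
        by (auto simp: member_def family_rank_def algebra_simps)
      then show "\<exists>m. member ?F' q0 ((scaling_step b q0 I ^^ m) s)"
        by (intro exI[of _ 1]) simp
      qed
    qed
  qed (use F in \<open>auto simp: reached_def\<close>)
  then show thesis
    using that j by blast
qed

text \<open>Without vanishing jobs the choice of the job and the length of its probing do not depend
  on \<open>q0\<close>, so the clock advances by a constant.\<close>

lemma probe_family:
  assumes F: "reached F" and A: "ready F \<inter> vanishing F = {}" "ready F \<noteq> {}"
  obtains j t where "j \<in> ready F" "0 < t"
    "reached (F\<lparr>base := base F + t, offset := (offset F)(j := offset F j + 1),
       finished := (if final_rank j \<le> offset F j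
                    then (finished F)(j \<mapsto> (base F + t, slope F)) else finished F)\<rparr>)"
proof -
  obtain j where j: "j \<in> ready F" and
    min: "\<And>i. i \<in> ready F \<Longrightarrow> offset F j < offset F i \<or> offset F j = offset F i \<and> j \<le> i"
    using lex_min_exists[OF finite_ready A(2)] by blast
  then have jn: "j < n" by (simp add: ready_def)
  define t where "t = min (p j) (w j * b powi offset F j)"
  let ?F' = "F\<lparr>base := base F + t, offset := (offset F)(j := offset F j + 1),
       finished := (if final_rank j \<le> offset F j
                    then (finished F)(j \<mapsto> (base F + t, slope F)) else finished F)\<rparr>"
  have "reached ?F'"
  proof (rule reachedI[OF F])
    show "\<forall>\<^sub>F q0 in at_bot. \<forall>s. member F q0 s \<longrightarrow> available I s = ready F \<longrightarrow>
               (\<exists>m. member ?F' q0 ((scaling_step b q0 I ^^ m) s))"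
    proof (intro always_eventually allI impI)
      fix q0 s assume ms: "member F q0 s" and av: "available I s = ready F"
      then have s: "consistent q0 s" "clock s = base F + slope F * b powi q0"
        "\<And>i. i < n \<Longrightarrow> rk q0 s i = family_rank F q0 i"
        by (auto simp: member_def)
      have rk: "rk q0 s i = offset F i" if "i \<in> ready F" for i
        using that A(1) s(3)[of i] by (auto simp: family_rank_def ready_def)
      have nj: "next_job b q0 I s = j"
        using j min rk by (intro next_job_eqI) (auto simp: av)
      note step = step_probe[OF s(1) A(2)[folded av], unfolded nj rk[OF j]]
      have "member ?F' q0 (scaling_step b q0 I s)"
        using ms step s j A(1) by (auto simp: member_def family_rank_def t_def)
      then show "\<exists>m. member ?F' q0 ((scaling_step b q0 I ^^ m) s)"
        by (intro exI[of _ 1]) simp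
    qed
  qed (use F in \<open>auto simp: reached_def\<close>)
  moreover have "0 < t"
    using proc_pos[OF jn] weight_pos[OF jn] powi_pos by (simp add: t_def)
  ultimately show thesis
    using that j by blast
qed

text \<open>\<open>rank_phase\<close> lifts all ready vanishing jobs to a fixed rank
  \<open>Q\<close>, so low that no release and no completion falls into the phase and no absolute
  rank is below \<open>Q\<close>. Afterwards the ranks of these jobs are absolute.\<close>

lemma phase_family:
  assumes F: "reached F" and A: "ready F \<inter> vanishing F \<noteq> {}"
    and rel: "\<And>j. j < n \<Longrightarrow> \<not> released F j \<Longrightarrow> base F < r j"
  obtains Q t y where "0 < t"
    "reached (F\<lparr>base := base F + t, slope := y, vanishing := vanishing F - ready F,
       offset := (\<lambda>j. if j \<in> ready F \<inter> vanishing F then Q else offset F j)\<rparr>)"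
proof -
  let ?X = "ready F \<inter> vanishing F"
  have X: "finite ?X" "\<And>i. i \<in> ?X \<Longrightarrow> i < n"
    using finite_ready by (auto simp: ready_def)
  define h where "h = (\<Sum>i\<in>?X. w i) / (b - 1)"
  have "\<forall>\<^sub>F Q in at_bot. \<forall>j\<in>{j. j < n \<and> \<not> released F j}. base F + h * b powi Q < r j"
    using rel by (intro eventually_ball_finite ballI eventually_less) auto
  moreover have "\<forall>\<^sub>F Q in at_bot. \<forall>j\<in>{..<n}. Q + 0 \<le> final_rank j"
    by (intro eventually_ball_finite ballI eventually_le_const) auto
  moreover have "\<forall>\<^sub>F Q in at_bot. \<forall>j\<in>{..<n}. Q + 0 \<le> offset F j"
    by (intro eventually_ball_finite ballI eventually_le_const) auto
  ultimately have "\<forall>\<^sub>F Q in at_bot. (\<forall>j\<in>{j. j < n \<and> \<not> released F j}. base F + h * b powi Q < r j) \<and>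
      (\<forall>j\<in>{..<n}. Q + 0 \<le> final_rank j) \<and> (\<forall>j\<in>{..<n}. Q + 0 \<le> offset F j)"
    by (simp add: eventually_conj_iff)
  then obtain Q where Q: "\<And>j. j < n \<Longrightarrow> \<not> released F j \<Longrightarrow> base F + h * b powi Q < r j"
    "\<And>j. j < n \<Longrightarrow> Q \<le> final_rank j" "\<And>j. j < n \<Longrightarrow> Q \<le> offset F j"
    using eventually_happens[of _ "at_bot :: int filter"] by fastforce
  \<comment> \<open>The phase lasts \<open>t - g * b powi q0\<close>, a difference of geometric
    sums: \<open>t\<close> collects all ranks below \<open>Q\<close>, the other term those below the
    current ranks.\<close>
  define t where "t = h * b powi Q"
  define g where "g = (\<Sum>i\<in>?X. w i * b powi offset F i) / (b - 1)"
  define F' where "F' = F\<lparr>base := base F + t, slope := slope F - g, vanishing := vanishing F - ready F,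
       offset := (\<lambda>j. if j \<in> ?X then Q else offset F j)\<rparr>"
  have "0 < h"
    unfolding h_def using X A weight_pos b_gt_1 by (intro divide_pos_pos sum_pos) auto
  then have "0 < t"
    using powi_pos by (simp add: t_def)
  have "reached F'"
  proof (rule reachedI[OF F])
    have "\<forall>\<^sub>F q0 in at_bot. \<forall>j\<in>{j. j < n \<and> \<not> released F j}. (base F + t) + (slope F - g) * b powi q0 < r j"
      using Q(1) by (intro eventually_ball_finite ballI eventually_less) (auto simp: t_def)
    moreover have "\<forall>\<^sub>F q0 in at_bot. \<forall>i\<in>ready F. q0 + offset F i \<le> Q"
      by (intro eventually_ball_finite finite_ready ballI eventually_le_const)
    ultimately show "\<forall>\<^sub>F q0 in at_bot. \<forall>s. member F q0 s \<longrightarrow> available I s = ready F \<longrightarrow>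
               (\<exists>m. member F' q0 ((scaling_step b q0 I ^^ m) s))"
      using eventually_released[of F]
    proof eventually_elim
      case (elim q0)
      show ?case
      proof (intro allI impI)
      fix s assume "member F q0 s" "available I s = ready F"
      note elim = elim this
      then have s: "consistent q0 s" "clock s = base F + slope F * b powi q0"
        "\<And>i. i < n \<Longrightarrow> rk q0 s i = family_rank F q0 i"
        by (auto simp: member_def)
      have rX: "rk q0 s i = q0 + offset F i" if "i \<in> ?X" for i
        using s(3)[of i] that X by (auto simp: family_rank_def)
      have "(\<Sum>i\<in>?X. w i * (b powi Q - b powi rk q0 s i) / (b - 1))
          = (\<Sum>i\<in>?X. w i * b powi Q / (b - 1) - w i * b powi offset F i / (b - 1) * b powi q0)"
        using b_nonzero
        by (intro sum.cong) (auto simp: rX power_int_add right_diff_distrib diff_divide_distrib)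
      also have "\<dots> = t - g * b powi q0"
        by (simp add: sum_subtractf t_def h_def g_def sum_divide_distrib sum_distrib_right)
      finally have sum: "clock s + (\<Sum>i\<in>?X. w i * (b powi Q - b powi rk q0 s i) / (b - 1))
          = base F' + slope F' * b powi q0"
        by (simp add: s(2) F'_def algebra_simps)
      have "\<exists>m. let s' = (scaling_step b q0 I ^^ m) s in consistent q0 s' \<and>
           clock s' = clock s + (\<Sum>i\<in>?X. w i * (b powi Q - b powi rk q0 s i) / (b - 1)) \<and>
           (\<forall>i<n. rk q0 s' i = (if i \<in> ?X then Q else rk q0 s i)) \<and> completed s' = completed s"
      proof (rule rank_phase[OF s(1)])
        show "rk q0 s i \<le> Q" if "i \<in> ?X" for i
          using rX[OF that] elim(2) that by auto
        show "Q \<le> rk q0 s i" if "i \<in> available I s" "i \<notin> ?X" for i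
          using that elim(5) s(3)[of i] Q(3)[of i] by (auto simp: family_rank_def ready_def)
        show "clock s + (\<Sum>i\<in>?X. w i * (b powi Q - b powi rk q0 s i) / (b - 1)) < r j"
          if "j < n" "clock s < r j" for j
          unfolding sum using elim(1,3) that s(2) by (auto simp: F'_def)
      qed (use elim(5) Q(2) X in auto)
      then show "\<exists>m. member F' q0 ((scaling_step b q0 I ^^ m) s)"
        unfolding sum using elim(4) s(3)
        by (auto simp: member_def Let_def F'_def family_rank_def ready_def)
      qed
    qed
  qed (use F in \<open>auto simp: reached_def F'_def\<close>)
  then show thesis
    using that \<open>0 < t\<close> unfolding F'_def by blast
qed

section \<open>A well-founded measure on state families\<close>

definition min_weight :: real where
  "min_weight = Min (w ` {..<n})"

lemma min_weight: "j < n \<Longrightarrow> 0 < min_weight \<and> min_weight \<le> w j"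
  using weight_pos by (subst (1) min_weight_def, subst Min_gr_iff) (auto simp: min_weight_def)

text \<open>With ready vanishing jobs this bounds the number of vanishing probings until the slope
  is nonnegative, each adding at least \<open>min_weight\<close>; otherwise it counts the probings
  that the ready jobs may still receive.\<close>

definition pending :: "state_family \<Rightarrow> nat" where
  "pending F = (if ready F \<inter> vanishing F \<noteq> {} then nat \<lceil>- slope F / min_weight\<rceil>
                else (\<Sum>j\<in>ready F. nat (final_rank j + 1 - offset F j)))"

text \<open>Releases come first because they may enlarge the other two components; the end of a
  vanishing phase may enlarge \<open>pending\<close>.\<close>

definition progress :: "(state_family \<times> state_family) set" where
  "progress = inv_image (less_than <*lex*> less_than <*lex*> less_than)
     (\<lambda>F. (card {j. j < n \<and> \<not> released F j}, card (ready F \<inter> vanishing F), pending F))"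

lemma wf_progress: "wf progress"
  by (auto simp: progress_def)

lemma progressI:
  assumes mono: "\<And>j. j < n \<Longrightarrow> released F j \<Longrightarrow> released F' j"
    and dec: "(\<And>j. j < n \<Longrightarrow> released F' j \<longleftrightarrow> released F j) \<Longrightarrow>
      card (ready F' \<inter> vanishing F') < card (ready F \<inter> vanishing F) \<or>
      card (ready F' \<inter> vanishing F') = card (ready F \<inter> vanishing F) \<and> pending F' < pending F"
  shows "(F', F) \<in> progress"
proof -
  let ?U = "\<lambda>F. {j. j < n \<and> \<not> released F j}"
  have sub: "?U F' \<subseteq> ?U F"
    using mono by auto
  show ?thesis
  proof (cases "?U F' = ?U F")
    case True
    then show ?thesis
      using dec by (auto simp: progress_def)
  next
    case False
    then have "card (?U F') < card (?U F)"
      using sub by (intro psubset_card_mono) auto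
    then show ?thesis
      by (simp add: progress_def)
  qed
qed

lemma progress_exists:
  assumes F: "reached F" and j0: "j0 < n" "finished F j0 = None"
  shows "\<exists>F'. reached F' \<and> (F', F) \<in> progress"
proof -
  \<comment> \<open>The cases: idling; a release at \<open>base\<close> that the clock has not quite
    reached, so that single vanishing probings must be followed; no such release, so that a whole
    phase is bridged; only absolute ranks, hence an ordinary probing.\<close>
  consider "ready F = {}"
    | j where "j < n" "\<not> released F j" "r j \<le> base F" "ready F \<inter> vanishing F \<noteq> {}"
    | "\<And>j. j < n \<Longrightarrow> \<not> released F j \<Longrightarrow> base F < r j" "ready F \<inter> vanishing F \<noteq> {}"
    | "ready F \<noteq> {}" "ready F \<inter> vanishing F = {}"
    by (meson linorder_not_le)
  then show ?thesis
  proof cases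
    case 1
    let ?X = "{j. j < n \<and> finished F j = None}"
    let ?F' = "F\<lparr>base := Min (r ` ?X), slope := 0\<rparr>"
    have "Min (r ` ?X) \<in> r ` ?X"
      using j0 by (intro Min_in) auto
    then obtain j where j: "j < n" "finished F j = None" "r j = Min (r ` ?X)"
      by auto
    \<comment> \<open>Slope 0 makes \<open>j\<close> count as released even if its release date
      equals the old \<open>base\<close>.\<close>
    then have "\<not> released F j" "released ?F' j"
      using 1 by (auto simp: ready_def released_def)
    moreover have "base F \<le> base ?F'"
      using \<open>\<not> released F j\<close> j by (auto simp: released_def)
    then have "\<And>i. released F i \<Longrightarrow> released ?F' i"
      by (auto simp: released_def)
    ultimately have "(?F', F) \<in> progress"
      using j(1) by (intro progressI) blast+
    then show ?thesis
      using idle_family[OF F 1 j0] by blast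
  next
    case (2 j)
    obtain i where i: "i \<in> ready F \<inter> vanishing F" and
      F': "reached (F\<lparr>slope := slope F + w i * b powi offset F i, offset := (offset F)(i := offset F i + 1)\<rparr>)"
      (is "reached ?F'")
      using vanishing_family[OF F 2(4)] by blast
    have neg: "slope F < 0"
      using 2(2,3) by (auto simp: released_def)
    have "0 \<le> offset F i" "i < n"
      using F i by (auto simp: reached_def ready_def)
    then have w: "0 < min_weight" "min_weight \<le> w i * b powi offset F i"
      using min_weight[of i] weight_pos[of i] powi_le_iff[of 0 "offset F i"]
        mult_mono[of min_weight "w i" 1 "b powi offset F i"] by auto
    have "(?F', F) \<in> progress"
    proof (rule progressI)
      assume rel: "\<And>j. j < n \<Longrightarrow> released ?F' j \<longleftrightarrow> released F j"
      then have ready: "ready ?F' = ready F"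
        by (auto simp: ready_def)
      have "- slope ?F' / min_weight \<le> (- slope F - min_weight) / min_weight"
        using w by (intro divide_right_mono) auto
      also have "\<dots> = - slope F / min_weight - 1"
        using w by (simp add: diff_divide_distrib)
      finally have "\<lceil>- slope ?F' / min_weight\<rceil> \<le> \<lceil>- slope F / min_weight\<rceil> - 1"
        by linarith
      moreover have "0 < \<lceil>- slope F / min_weight\<rceil>"
        using neg w by (simp add: divide_neg_pos)
      ultimately have "pending ?F' < pending F"
        using 2(4) ready by (simp add: pending_def)
      then show "card (ready ?F' \<inter> vanishing ?F') < card (ready F \<inter> vanishing F) \<or>
        card (ready ?F' \<inter> vanishing ?F') = card (ready F \<inter> vanishing F) \<and> pending ?F' < pending F"
        using ready by simp
    qed (use w in \<open>auto simp: released_def\<close>)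
    then show ?thesis
      using F' by blast
  next
    case 3
    obtain Q t y where t: "0 < t" and
      F': "reached (F\<lparr>base := base F + t, slope := y, vanishing := vanishing F - ready F,
       offset := (\<lambda>j. if j \<in> ready F \<inter> vanishing F then Q else offset F j)\<rparr>)" (is "reached ?F'")
      using phase_family[OF F 3(2,1)] by blast
    have "(?F', F) \<in> progress"
    proof (rule progressI)
      assume "\<And>j. j < n \<Longrightarrow> released ?F' j \<longleftrightarrow> released F j"
      then have "ready ?F' = ready F"
        by (auto simp: ready_def)
      then have "ready ?F' \<inter> vanishing ?F' = {}"
        by auto
      then show "card (ready ?F' \<inter> vanishing ?F') < card (ready F \<inter> vanishing F) \<or>
        card (ready ?F' \<inter> vanishing ?F') = card (ready F \<inter> vanishing F) \<and> pending ?F' < pending F"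
        using 3(2) finite_ready by (simp add: card_gt_0_iff)
    qed (use t in \<open>auto simp: released_def\<close>)
    then show ?thesis
      using F' by blast
  next
    case 4
    obtain j t where j: "j \<in> ready F" and t: "0 < t" and
      F': "reached (F\<lparr>base := base F + t, offset := (offset F)(j := offset F j + 1),
       finished := (if final_rank j \<le> offset F j
                    then (finished F)(j \<mapsto> (base F + t, slope F)) else finished F)\<rparr>)" (is "reached ?F'")
      using probe_family[OF F 4(2,1)] by blast
    have "(?F', F) \<in> progress"
    proof (rule progressI)
      assume rel: "\<And>j. j < n \<Longrightarrow> released ?F' j \<longleftrightarrow> released F j"
      have sub: "ready ?F' \<subseteq> ready F"
        using rel by (auto simp: ready_def split: if_splits)
      then have disj: "ready ?F' \<inter> vanishing ?F' = {}"
        using 4(2) by auto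
      \<comment> \<open>The summand of \<open>j\<close> is thus positive before the probing, and
        truncation by \<open>nat\<close> cannot hide its decrease.\<close>
      have le: "offset F j \<le> final_rank j"
        using reached_offset_le[OF F j] 4(2) j by blast
      let ?f = "\<lambda>F i. nat (final_rank i + 1 - offset F i)"
      have "(\<Sum>i\<in>ready ?F'. ?f ?F' i) \<le> (\<Sum>i\<in>ready F. ?f ?F' i)"
        using sub finite_ready by (intro sum_mono2) auto
      also have "\<dots> < (\<Sum>i\<in>ready F. ?f F i)"
        using le j finite_ready by (intro sum_strict_mono_ex1) auto
      finally have "pending ?F' < pending F"
        using disj 4(2) by (simp add: pending_def)
      then show "card (ready ?F' \<inter> vanishing ?F') < card (ready F \<inter> vanishing F) \<or>
        card (ready ?F' \<inter> vanishing ?F') = card (ready F \<inter> vanishing F) \<and> pending ?F' < pending F"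
        using disj 4(2) by simp
    qed (use t in \<open>auto simp: released_def\<close>)
    then show ?thesis
      using F' by blast
  qed
qed

lemma complete_family_exists:
  obtains F where "reached F" "\<And>j. j < n \<Longrightarrow> finished F j \<noteq> None"
proof -
  \<comment> \<open>Every job starts at rank \<open>q0\<close>, that is, with a vanishing rank of
    offset 0.\<close>
  define F0 where "F0 = \<lparr>base = 0, slope = 0, vanishing = UNIV, offset = (\<lambda>_. 0), finished = (\<lambda>_. None)\<rparr>"
  have "\<forall>\<^sub>F q0 in at_bot. \<forall>j\<in>{..<n}. q0 + 0 \<le> final_rank j"
    by (intro eventually_ball_finite ballI eventually_le_const) auto
  then have "\<forall>\<^sub>F q0 in at_bot. member F0 q0 ((scaling_step b q0 I ^^ 0) init_state)"
    by eventually_elim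
      (auto simp: member_def F0_def consistent_def init_state_def family_rank_def Defs.rank_def)
  then have "\<forall>\<^sub>F q0 in at_bot. \<exists>m. member F0 q0 ((scaling_step b q0 I ^^ m) init_state)"
    by (rule eventually_mono) (rule exI)
  then have "reached F0"
    unfolding reached_def by (simp add: F0_def)
  moreover have "\<exists>F'. reached F' \<and> (\<forall>j<n. finished F' j \<noteq> None)" if "reached F" for F
    using wf_progress that
  proof (induction F rule: wf_induct_rule)
    case (less F)
    then show ?case
      using progress_exists[OF less.prems] by blast
  qed
  ultimately show thesis
    using that by blast
qed

text \<open>In a family with all jobs finished the completion times are affine in
  \<open>b powi q0\<close> and converge to their constant terms. Reaching its members also yields
  the termination hypothesis of \<open>scaling_run\<close>.\<close>

lemma scaling_completion_limit:
  obtains x y where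
    "\<forall>j<n. scaling_completion b I j = x j"
    "\<forall>\<^sub>F q0 in at_bot. scaling_run b I q0 \<and>
       (\<forall>j<n. \<exists>m. completed ((scaling_step b q0 I ^^ m) init_state) j = Some (x j + y j * b powi q0))"
proof -
  obtain F where F: "reached F" "\<And>j. j < n \<Longrightarrow> finished F j \<noteq> None"
    using complete_family_exists by blast
  define x where "x j = fst (the (finished F j))" for j
  define y where "y j = snd (the (finished F j))" for j
  have fin: "finished F j = Some (x j, y j)" if "j < n" for j
    using F(2)[OF that] by (auto simp: x_def y_def)
  have "\<forall>\<^sub>F q0 in at_bot. \<forall>j\<in>{..<n}. q0 + 0 \<le> final_rank j"
    by (intro eventually_ball_finite ballI eventually_le_const) auto
  moreover have "\<forall>\<^sub>F q0 in at_bot. \<exists>m. member F q0 ((scaling_step b q0 I ^^ m) init_state)"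
    using F(1) by (simp add: reached_def)
  ultimately have ev: "\<forall>\<^sub>F q0 in at_bot. scaling_run b I q0 \<and>
       (\<forall>j<n. \<exists>m. completed ((scaling_step b q0 I ^^ m) init_state) j = Some (x j + y j * b powi q0))"
  proof eventually_elim
    case (elim q0)
    then obtain m where "\<And>j. j < n \<Longrightarrow>
        completed ((scaling_step b q0 I ^^ m) init_state) j = Some (x j + y j * b powi q0)"
      using fin by (auto simp: member_def)
    then have co: "\<forall>j<n. \<exists>m. completed ((scaling_step b q0 I ^^ m) init_state) j = Some (x j + y j * b powi q0)"
      by blast
    have "scaling_run b I q0"
    proof
      show "q0 \<le> final_rank j" if "j < n" for j
        using elim(1) that by auto
      show "\<exists>m. completed ((scaling_step b q0 I ^^ m) init_state) j \<noteq> None" if "j < n" for j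
        using co that by (metis option.distinct(1))
    qed
    then show ?case
      using co by simp
  qed
  have "scaling_completion b I j = x j" if j: "j < n" for j
  proof -
    have "\<forall>\<^sub>F q0 in at_bot. truncated_completion b q0 I j = x j + y j * b powi q0"
      using ev
    proof eventually_elim
      case (elim q0)
      then interpret scaling_run b I q0 by simp
      obtain m where m: "completed (S m) j = Some (x j + y j * b powi q0)"
        using elim j by (auto simp: S_def)
      show ?case
        unfolding truncated_completion_def S_def[symmetric]
      proof (rule the_equality)
        fix t assume "\<exists>m. completed (S m) j = Some t"
        then show "t = x j + y j * b powi q0"
          using completed_unique[OF _ m] by blast
      qed (use m in blast)
    qed
    moreover have "((\<lambda>q0. x j + y j * b powi q0) \<longlongrightarrow> x j + y j * 0) at_bot"
      by (intro tendsto_intros powi_tendsto_0)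
    ultimately have "((\<lambda>q0. truncated_completion b q0 I j) \<longlongrightarrow> x j) at_bot"
      by (subst tendsto_cong) simp_all
    then show ?thesis
      unfolding scaling_completion_def by (intro tendsto_Lim) auto
  qed
  then show thesis
    using ev that by blast
qed

text \<open>\<open>cost_bound\<close> holds for all small \<open>q0\<close>; in the limit both the
  slopes and the delay vanish.\<close>

lemma scaling_cost_le:
  assumes "preemptive_schedule I \<sigma>"
  shows "scaling_cost b I \<le> 2 * (b\<^sup>2 / (b - 1)) * (\<Sum>j<n. w j * preemptive_completion I \<sigma> j)"
proof -
  let ?C = "preemptive_completion I \<sigma>"
  obtain x y where x: "\<forall>j<n. scaling_completion b I j = x j" and
    ev: "\<forall>\<^sub>F q0 in at_bot. scaling_run b I q0 \<and>
       (\<forall>j<n. \<exists>m. completed ((scaling_step b q0 I ^^ m) init_state) j = Some (x j + y j * b powi q0))"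
    by (rule scaling_completion_limit)
  have le: "\<forall>\<^sub>F q0 in at_bot. (\<Sum>j<n. w j * (x j + y j * b powi q0))
      \<le> 2 * (b\<^sup>2 / (b - 1)) * (\<Sum>j<n. w j * (?C j + (\<Sum>k<n. w k) * b powi q0))"
    using ev
  proof eventually_elim
    case (elim q0)
    then interpret scaling_run b I q0 by simp
    show ?case
      using elim cost_bound[OF assms, of "\<lambda>j. x j + y j * b powi q0"] by (simp add: S_def delay_def)
  qed
  have "(\<Sum>j<n. w j * (x j + y j * 0))
      \<le> 2 * (b\<^sup>2 / (b - 1)) * (\<Sum>j<n. w j * (?C j + (\<Sum>k<n. w k) * 0))"
  proof (rule tendsto_le[OF _ _ _ le])
    show "((\<lambda>q0. 2 * (b\<^sup>2 / (b - 1)) * (\<Sum>j<n. w j * (?C j + (\<Sum>k<n. w k) * b powi q0))) \<longlongrightarrow>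
      2 * (b\<^sup>2 / (b - 1)) * (\<Sum>j<n. w j * (?C j + (\<Sum>k<n. w k) * 0))) at_bot"
      by (intro tendsto_mult_left tendsto_sum tendsto_add tendsto_const powi_tendsto_0)
    show "((\<lambda>q0. \<Sum>j<n. w j * (x j + y j * b powi q0)) \<longlongrightarrow> (\<Sum>j<n. w j * (x j + y j * 0))) at_bot"
      by (intro tendsto_mult_left tendsto_sum tendsto_add tendsto_const powi_tendsto_0)
  qed simp
  then show ?thesis
    by (simp add: scaling_cost_def x)
qed

end

section \<open>The competitive ratio\<close>

text \<open>Makes the infimum in \<open>OPT\<close> range over a nonempty set. The jobs run without
  preemption in index order from the sum of all release dates on, when all of them are
  released.\<close>

lemma preemptive_schedule_exists:
  assumes I: "valid_instance I"
  shows "\<exists>\<sigma>. preemptive_schedule I \<sigma>"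
proof -
  define start where "start k = (\<Sum>i<num_jobs I. release I i) + (\<Sum>i<k. proc I i)" for k
  define \<sigma> where "\<sigma> t = (if \<exists>j<num_jobs I. start j \<le> t \<and> t < start (Suc j)
    then Some (THE j. j < num_jobs I \<and> start j \<le> t \<and> t < start (Suc j)) else None)" for t
  have pos: "0 \<le> proc I i" "0 \<le> release I i" if "i < num_jobs I" for i
    using I that by (auto simp: valid_instance_def less_imp_le)
  have mono: "start i \<le> start k" if "i \<le> k" "k \<le> num_jobs I" for i k
    unfolding start_def using that pos by (intro add_left_mono sum_mono2) auto
  have unique: "i = k" if "i < num_jobs I" "k < num_jobs I" "start i \<le> t" "t < start (Suc i)"
    "start k \<le> t" "t < start (Suc k)" for i k t
    using that mono[of "Suc i" k] mono[of "Suc k" i] by (cases i k rule: linorder_cases) auto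
  have \<sigma>: "\<sigma> t = Some j \<longleftrightarrow> j < num_jobs I \<and> start j \<le> t \<and> t < start (Suc j)" for t j
  proof
    assume "\<sigma> t = Some j"
    then have ex: "\<exists>j<num_jobs I. start j \<le> t \<and> t < start (Suc j)" and
      j: "j = (THE j. j < num_jobs I \<and> start j \<le> t \<and> t < start (Suc j))"
      by (auto simp: \<sigma>_def split: if_splits)
    show "j < num_jobs I \<and> start j \<le> t \<and> t < start (Suc j)"
      unfolding j by (rule theI') (use ex unique in blast)
  next
    assume j: "j < num_jobs I \<and> start j \<le> t \<and> t < start (Suc j)"
    then have "(THE j. j < num_jobs I \<and> start j \<le> t \<and> t < start (Suc j)) = j"
      using unique by blast
    then show "\<sigma> t = Some j"
      using j by (auto simp: \<sigma>_def)
  qed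
  have start_ge: "release I j \<le> start j" "0 \<le> start j" if "j < num_jobs I" for j
  proof -
    have "release I j \<le> (\<Sum>i<num_jobs I. release I i)"
      using pos that by (intro member_le_sum) auto
    moreover have "0 \<le> (\<Sum>i<j. proc I i)"
      using pos that by (intro sum_nonneg) auto
    ultimately show "release I j \<le> start j" "0 \<le> start j"
      using pos[OF that] by (auto simp: start_def)
  qed
  have set: "{t. \<sigma> t = Some j} = {start j..<start (Suc j)}" if "j < num_jobs I" for j
    using that by (auto simp: \<sigma>)
  have "proc I j \<le> processed \<sigma> j (start (Suc j))" if "j < num_jobs I" for j
  proof -
    have "{s \<in> {0..start (Suc j)}. \<sigma> s = Some j} = {start j..<start (Suc j)}"
      using that start_ge[OF that] by (auto simp: \<sigma>)
    moreover have "start j \<le> start (Suc j)"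
      using mono that by simp
    moreover have "start (Suc j) - start j = proc I j"
      by (simp add: start_def)
    ultimately show ?thesis
      by (simp only: processed_def) simp
  qed
  moreover have "release I j \<le> t" if "\<sigma> t = Some j" for t j
    using that start_ge[of j] by (auto simp: \<sigma>)
  ultimately have "preemptive_schedule I \<sigma>"
    unfolding preemptive_schedule_def using set \<sigma> by auto
  then show ?thesis by blast
qed

lemma competitive_scaling:
  assumes b: "1 < b"
  shows "competitive (scaling_cost b) (2 * (b\<^sup>2 / (b - 1)))"
  unfolding competitive_def
proof (intro allI impI)
  fix I assume I: "valid_instance I"
  interpret scaling_setting b I
    using b I by unfold_locales
  let ?c = "2 * (b\<^sup>2 / (b - 1))"
  let ?X = "{\<Sum>j<n. w j * preemptive_completion I \<sigma> j |\<sigma>. preemptive_schedule I \<sigma>}"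
  have c: "0 < ?c"
    using b by simp
  have "scaling_cost b I / ?c \<le> Inf ?X"
  proof (rule cInf_greatest)
    show "?X \<noteq> {}"
      using preemptive_schedule_exists[OF I] by blast
    fix z assume "z \<in> ?X"
    then have "scaling_cost b I \<le> ?c * z"
      using scaling_cost_le by auto
    then show "scaling_cost b I / ?c \<le> z"
      using c by (simp only: pos_divide_le_eq mult.commute)
  qed
  then show "scaling_cost b I \<le> ?c * OPT I"
    using c unfolding OPT_def[symmetric] by (simp only: pos_divide_le_eq mult.commute)
qed

text \<open>Used to pass from a smaller competitive ratio to a larger one.\<close>

lemma OPT_nonneg:
  assumes I: "valid_instance I"
  shows "0 \<le> OPT I"
  unfolding OPT_def
proof (rule cInf_greatest)
  show "{\<Sum>j<num_jobs I. weight I j * preemptive_completion I \<sigma> j |\<sigma>. preemptive_schedule I \<sigma>} \<noteq> {}"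
    using preemptive_schedule_exists[OF I] by blast
  fix z assume "z \<in> {\<Sum>j<num_jobs I. weight I j * preemptive_completion I \<sigma> j |\<sigma>. preemptive_schedule I \<sigma>}"
  then show "0 \<le> z"
    using completion_ge_start[OF I, of _ _ 0] I
    by (auto simp: valid_instance_def less_imp_le intro!: sum_nonneg mult_nonneg_nonneg)
qed

lemma competitive_scaling_ratio:
  assumes b: "1 < b"
  shows "competitive (scaling_cost b) (scaling_ratio b)"
proof -
  have "2 * b - 1 \<le> b\<^sup>2"
    using zero_le_power2[of "b - 1"] by (simp add: power2_eq_square algebra_simps)
  \<comment> \<open>The claimed ratio is the proved one times \<open>b^2 / (2 * b - 1)\<close>, a
    factor of at least 1.\<close>
  then have "2 * (b\<^sup>2 / (b - 1)) * 1 \<le> 2 * (b\<^sup>2 / (b - 1)) * (b\<^sup>2 / (2 * b - 1))"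
    using b by (intro mult_left_mono) auto
  also have "\<dots> = scaling_ratio b"
  proof -
    have "2 * b\<^sup>2 - 3 * b + 1 = (b - 1) * (2 * b - 1)"
      by (simp add: power2_eq_square algebra_simps)
    then show ?thesis
      by (simp add: scaling_ratio_def power4_eq_xxxx power2_eq_square mult_ac)
  qed
  finally have "2 * (b\<^sup>2 / (b - 1)) \<le> scaling_ratio b"
    by simp
  then show ?thesis
    using competitive_scaling[OF b] OPT_nonneg mult_right_mono unfolding competitive_def
    by (meson order_trans)
qed

section \<open>Minimizing the ratio\<close>

lemma scaling_ratio_ge:
  assumes b: "1 < b"
  shows "(107 + 51 * sqrt 17) / 32 \<le> scaling_ratio b"
proof -
  \<comment> \<open>The only critical point above 1: the numerator of the derivative is a multiple
    of \<open>b^3 * (4 * b^2 - 9 * b + 4)\<close>.\<close>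
  define \<beta> :: real where "\<beta> = (9 + sqrt 17) / 8"
  have sqrt: "sqrt 17 * sqrt 17 = 17" "4 < sqrt 17" "sqrt 17 < 5"
    by (auto intro!: real_less_rsqrt real_less_lsqrt)
  then have \<beta>: "4 * \<beta>\<^sup>2 = 9 * \<beta> - 4" "1 < \<beta>" "\<beta> < 2"
    by (auto simp: \<beta>_def power2_eq_square field_simps)
  have ratio: "(107 + 51 * sqrt 17) / 32 = (51 * \<beta> - 44) / 4"
    by (simp add: \<beta>_def field_simps)
  have D: "0 < 2 * b\<^sup>2 - 3 * b + 1"
  proof -
    have "2 * b\<^sup>2 - 3 * b + 1 = (b - 1) * (2 * b - 1)"
      by (simp add: power2_eq_square algebra_simps)
    then show ?thesis
      using b by simp
  qed
  \<comment> \<open>A stationary point is a double root of this difference, hence the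
    square.\<close>
  have "4 * (2 * b ^ 4) - (51 * \<beta> - 44) * (2 * b\<^sup>2 - 3 * b + 1)
      = 4 * ((b - \<beta>)\<^sup>2 * (2 * b\<^sup>2 + 4 * \<beta> * b + (16 - 12 * \<beta>)))"
    using \<beta>(1) by algebra
  moreover have "0 \<le> (b - \<beta>)\<^sup>2 * (2 * b\<^sup>2 + 4 * \<beta> * b + (16 - 12 * \<beta>))"
  proof (rule mult_nonneg_nonneg)
    \<comment> \<open>These bound the second factor from below by \<open>18 - 8 * \<beta>\<close>,
      which is positive as \<open>\<beta> < 2\<close>.\<close>
    have "1 \<le> b\<^sup>2" "4 * \<beta> \<le> 4 * \<beta> * b"
      using b \<beta> by simp_all
    then show "0 \<le> 2 * b\<^sup>2 + 4 * \<beta> * b + (16 - 12 * \<beta>)"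
      using \<beta> by linarith
  qed simp
  ultimately show ?thesis
    unfolding ratio using D by (simp add: scaling_ratio_def pos_le_divide_eq)
qed

lemma scaling_ratio_minimum: "scaling_ratio ((9 + sqrt 17) / 8) = (107 + 51 * sqrt 17) / 32"
proof -
  define s :: real where "s = sqrt 17"
  have s: "s * s = 17" "4 < s"
    by (auto simp: s_def real_less_rsqrt)
  have 2: "((9 + s) / 8)\<^sup>2 = (49 + 9 * s) / 32"
    using s(1) by (simp add: power2_eq_square field_simps)
  have "((9 + s) / 8) ^ 4 = (((9 + s) / 8)\<^sup>2)\<^sup>2"
    by simp
  also have "\<dots> = (1889 + 441 * s) / 512"
    unfolding 2 using s(1) by (simp add: power2_eq_square field_simps)
  finally have 4: "((9 + s) / 8) ^ 4 = (1889 + 441 * s) / 512" .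
  have D: "2 * ((9 + s) / 8)\<^sup>2 - 3 * ((9 + s) / 8) + 1 = (11 + 3 * s) / 16"
    unfolding 2 by (simp add: field_simps)
  show ?thesis
    unfolding scaling_ratio_def s_def[symmetric] 4 D
    using s by (simp add: field_simps)
qed

theorem theorem1p7:
  shows "(\<forall>b::real. b > 1 \<longrightarrow> competitive (scaling_cost b) (scaling_ratio b)) \<and>
    is_arg_min scaling_ratio (\<lambda>b. b > 1) ((9 + sqrt 17) / 8) \<and>
    scaling_ratio ((9 + sqrt 17) / 8) = (107 + 51 * sqrt 17) / 32 \<and>
    competitive (scaling_cost ((9 + sqrt 17) / 8)) ((107 + 51 * sqrt 17) / 32) \<and>
    \<bar>(107 + 51 * sqrt 17) / 32 - 9.915\<bar> < (0.0005 :: real)"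
proof -
  have gt: "1 < (9 + sqrt 17) / 8"
    by (simp add: add_pos_pos)
  have "4.1229 < sqrt 17"
    by (rule real_less_rsqrt) (simp add: power2_eq_square)
  moreover have "sqrt 17 < 4.1233"
    by (rule real_less_lsqrt) (simp_all add: power2_eq_square)
  ultimately have "\<bar>(107 + 51 * sqrt 17) / 32 - 9.915\<bar> < (0.0005 :: real)"
    unfolding abs_less_iff by simp
  moreover have "is_arg_min scaling_ratio (\<lambda>b. b > 1) ((9 + sqrt 17) / 8)"
    unfolding is_arg_min_def scaling_ratio_minimum using gt scaling_ratio_ge by (meson linorder_not_less)
  ultimately show ?thesis
    using competitive_scaling_ratio competitive_scaling_ratio[OF gt] scaling_ratio_minimum by auto
qed

end
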